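(* Let $\Sigma$ be a signature. For every finite set $\Gamma$ of formulas of $\mathrm{LP}^{\supset,\mathsf{F}}(\Sigma)$ and every formula $A$ of $\mathrm{LP}^{\supset,\mathsf{F}}(\Sigma)$, the sequent $\Gamma \vdash A$ is provable in the natural deduction proof system of $\mathrm{LP}^{\supset,\mathsf{F}}(\Sigma)$ described below if and only if $\Gamma \models A$ (i.e. the system is sound and complete).
   Context: Language. Fix countably infinite, pairwise disjoint sets of variables and, for each arity $n\ge 0$, of $n$-ary function symbols and $n$-ary predicate symbols; a signature $\Sigma$ is a set of function and predicate symbols. Terms over $\Sigma$: variables, constants ($0$-ary function symbols) of $\Sigma$, and $f(t_1,\dots,t_{n+1})$ for $f\in\Sigma$ of arity $n+1$. Formulas of $\mathrm{LP}^{\supset,\mathsf{F}}(\Sigma)$: the falsity constant $\mathsf{F}$; $p$ for $0$-ary predicate symbols $p\in\Sigma$; $P(t_1,\dots,t_{n+1})$; $t_1=t_2$; $\neg A$; $A_1\wedge A_2$; $A_1\vee A_2$; $A_1\supset A_2$; $\forall x\,A$; $\exists x\,A$. $\mathsf{T}$ abbreviates $\neg\mathsf{F}$. $[x:=t]A$ denotes capture-avoiding substitution, $\mathrm{free}(\cdot)$ the set of free variables. Semantics. Truth values are $\mathsf{t}$ (true), $\mathsf{f}$ (false), $\mathsf{b}$ (both true and false). A structure $\mathbf{A}$ consists of a nonempty domain $U$, an element of $U$ for each constant, a function $U^{n+1}\to U$ for each $(n+1)$-ary function symbol, a value in $\{\mathsf t,\mathsf f,\mathsf b\}$ for each $0$-ary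 predicate symbol, a function $U^{n+1}\to\{\mathsf t,\mathsf f,\mathsf b\}$ for each $(n+1)$-ary predicate symbol, and a function $\mathrm{eq}:U\times U\to\{\mathsf t,\mathsf f,\mathsf b\}$ with $\mathrm{eq}(d,d)\in\{\mathsf t,\mathsf b\}$ for all $d\in U$. Given an assignment $\alpha$ of elements of $U$ to variables, terms are evaluated as usual; atomic formulas get the value given by the structure ($t_1=t_2$ gets $\mathrm{eq}$ of the values of $t_1,t_2$), $\mathsf F$ gets $\mathsf f$, and: $\neg A$ is $\mathsf t$ if $A$ is $\mathsf f$, $\mathsf f$ if $A$ is $\mathsf t$, else $\mathsf b$; $A_1\wedge A_2$ is $\mathsf t$ if both are $\mathsf t$, $\mathsf f$ if one is $\mathsf f$, else $\mathsf b$; $A_1\vee A_2$ is $\mathsf t$ if one is $\mathsf t$, $\mathsf f$ if both are $\mathsf f$, else $\mathsf b$; $A_1\supset A_2$ is $\mathsf t$ if $A_1$ is $\mathsf f$ or $A_2$ is $\mathsf t$, $\mathsf f$ if $A_1$ is not $\mathsf f$ and $A_2$ is $\mathsf f$, else $\mathsf b$; $\forall x\,A$ is $\mathsf t$ if $A$ is $\mathsf t$ under $\alpha(x\to d)$ for all $d\in U$, $\mathsf f$ if $A$ is $\mathsf f$ under $\alpha(x\to d)$ for some $d$, else $\mathsf b$; $\exists x\,A$ is $\mathsf t$ if $A$ is $\mathsf t$ for some $d$, $\mathsf f$ if $A$ is $\mathsf f$ for all $d$, else $\mathsf b$. For a finite set of formulas $\Gamma$ and formula $A$, $\Gamma\models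 A$ iff for every structure and assignment, some $A'\in\Gamma$ has value $\mathsf f$ or $A$ has value in $\{\mathsf t,\mathsf b\}$. Proof system. A sequent is $\Gamma\vdash A$ with $\Gamma$ a finite set of formulas ($\Gamma,A$ means $\Gamma\cup\{A\}$). Rules (premises / conclusion): (I) $\Gamma,A\vdash A$; ($\mathsf T$-I) $\Gamma\vdash\neg\mathsf F$; (EM) $\Gamma\vdash A\vee\neg A$; ($\mathsf F$-E) from $\Gamma\vdash\mathsf F$ infer $\Gamma\vdash A$; ($\wedge$-I) from $\Gamma\vdash A_1$ and $\Gamma\vdash A_2$ infer $\Gamma\vdash A_1\wedge A_2$; ($\wedge$-E) from $\Gamma\vdash A_1\wedge A_2$ infer $\Gamma\vdash A_i$ ($i=1,2$); ($\vee$-I) from $\Gamma\vdash A_i$ infer $\Gamma\vdash A_1\vee A_2$ ($i=1,2$); ($\vee$-E) from $\Gamma\vdash A_1\vee A_2$, $\Gamma,A_1\vdash A_3$, $\Gamma,A_2\vdash A_3$ infer $\Gamma\vdash A_3$; ($\supset$-I) from $\Gamma,A_1\vdash A_2$ infer $\Gamma\vdash A_1\supset A_2$; ($\supset$-E) from $\Gamma\vdash A_1\supset A_2$ and $\Gamma\vdash A_1$ infer $\Gamma\vdash A_2$; ($\forall$-I) from $\Gamma\vdash A$ infer $\Gamma\vdash\forall x\,A$, provided $x\notin\mathrm{free}(\Gamma)$; ($\forall$-E) from $\Gamma\vdash\forall x\,A$ infer $\Gamma\vdash[x:=t]A$; ($\exists$-I) from $\Gamma\vdash[x:=t]A$ infer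 $\Gamma\vdash\exists x\,A$; ($\exists$-E) from $\Gamma\vdash\exists x\,A_1$ and $\Gamma,A_1\vdash A_2$ infer $\Gamma\vdash A_2$, provided $x\notin\mathrm{free}(\Gamma\cup\{A_2\})$; ($=$-I) $\Gamma\vdash t=t$; ($=$-E) from $\Gamma\vdash t_1=t_2$ and $\Gamma\vdash[x:=t_1]A$ infer $\Gamma\vdash[x:=t_2]A$; and the two-way rules (each direction is a rule): $\Gamma\vdash\neg\neg A$ iff $\Gamma\vdash A$; $\Gamma\vdash\neg(A_1\wedge A_2)$ iff $\Gamma\vdash\neg A_1\vee\neg A_2$; $\Gamma\vdash\neg(A_1\vee A_2)$ iff $\Gamma\vdash\neg A_1\wedge\neg A_2$; $\Gamma\vdash\neg(A_1\supset A_2)$ iff $\Gamma\vdash A_1\wedge\neg A_2$; $\Gamma\vdash\neg\forall x\,A$ iff $\Gamma\vdash\exists x\,\neg A$; $\Gamma\vdash\neg\exists x\,A$ iff $\Gamma\vdash\forall x\,\neg A$. A proof is a finite sequence of sequents each of which is the conclusion of a rule instance whose premises occur earlier; a sequent is provable if it is the last element of a proof.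
   Formalization: Structures are also required to have eq(d,d') = f for distinct d, d'; with only eq(d,d) ∈ {t,b} the provable sequent x=y ⊢ y=x is not valid, so soundness fails. Formulas are identified up to renaming of bound variables. *)

theory Defs
  imports Main
begin

section \<open>Language\<close>

type_synonym var = nat

datatype fsym = Fsym (farity: nat) (findex: nat)
datatype psym = Psym (parity: nat) (pindex: nat)
datatype symbol = FunS fsym | PredS psym

type_synonym signat = "symbol set"

text \<open>
  Formulas are taken up to renaming of bound variables (without this identification the rules
  below do not derive, e.g., \<open>P(x), \<forall>y Q(y) \<turnstile> \<forall>x Q(x)\<close>, since \<open>x\<close> is free in the context).
  The classes are represented in locally nameless style: free variables are named, bound
  ones are de Bruijn indices. The paper's \<open>\<forall>x A\<close> and \<open>\<exists>x A\<close> are \<open>Forall x A\<close> and \<open>Exists x A\<close> below;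
  the raw constructors \<open>Bound\<close>, \<open>AllB\<close> and \<open>ExB\<close> do not occur in the rules. The lemmas \<open>Forall_rename\<close>, \<open>Forall_inject\<close>, \<open>free_Forall\<close>,
  \<open>subst_Forall\<close> and \<open>valuation_Forall\<close> (and those for \<open>Exists\<close>) state that the encoding behaves like named
  syntax. Constants and 0-ary predicate symbols are applied to the empty list.
\<close>

datatype tm = Var var | Bound nat | Fn fsym "tm list"

datatype fm =
    Falsity
  | Pred psym "tm list"
  | Eq tm tm
  | Neg fm
  | And fm fm
  | Or fm fm
  | Imp fm fm
  | AllB fm
  | ExB fm

fun free_tm :: "tm \<Rightarrow> var set" where
  "free_tm (Var y) = {y}"
| "free_tm (Bound i) = {}"
| "free_tm (Fn f ts) = (\<Union>t\<in>set ts. free_tm t)"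

primrec free :: "fm \<Rightarrow> var set" where
  "free Falsity = {}"
| "free (Pred p ts) = (\<Union>t\<in>set ts. free_tm t)"
| "free (Eq t1 t2) = free_tm t1 \<union> free_tm t2"
| "free (Neg A) = free A"
| "free (And A1 A2) = free A1 \<union> free A2"
| "free (Or A1 A2) = free A1 \<union> free A2"
| "free (Imp A1 A2) = free A1 \<union> free A2"
| "free (AllB A) = free A"
| "free (ExB A) = free A"

definition free_set :: "fm set \<Rightarrow> var set" where
  "free_set \<Gamma> = (\<Union>A\<in>\<Gamma>. free A)"

primrec subst_tm :: "var \<Rightarrow> tm \<Rightarrow> tm \<Rightarrow> tm" where
  "subst_tm x t (Var y) = (if y = x then t else Var y)"
| "subst_tm x t (Bound i) = Bound i"
| "subst_tm x t (Fn f ts) = Fn f (map (subst_tm x t) ts)"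

text \<open>\<open>subst x t A\<close> is \<open>[x:=t]A\<close>; no variable of \<open>t\<close> can be captured, because bound variables have no name.\<close>

primrec subst :: "var \<Rightarrow> tm \<Rightarrow> fm \<Rightarrow> fm" where
  "subst x t Falsity = Falsity"
| "subst x t (Pred p ts) = Pred p (map (subst_tm x t) ts)"
| "subst x t (Eq t1 t2) = Eq (subst_tm x t t1) (subst_tm x t t2)"
| "subst x t (Neg A) = Neg (subst x t A)"
| "subst x t (And A1 A2) = And (subst x t A1) (subst x t A2)"
| "subst x t (Or A1 A2) = Or (subst x t A1) (subst x t A2)"
| "subst x t (Imp A1 A2) = Imp (subst x t A1) (subst x t A2)"
| "subst x t (AllB A) = AllB (subst x t A)"
| "subst x t (ExB A) = ExB (subst x t A)"

text \<open>\<open>bind k x A\<close> makes the free occurrences of \<open>x\<close> refer to the \<open>k\<close>-th enclosing quantifier.\<close>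

primrec bind_tm :: "nat \<Rightarrow> var \<Rightarrow> tm \<Rightarrow> tm" where
  "bind_tm k x (Var y) = (if y = x then Bound k else Var y)"
| "bind_tm k x (Bound i) = Bound i"
| "bind_tm k x (Fn f ts) = Fn f (map (bind_tm k x) ts)"

primrec bind :: "nat \<Rightarrow> var \<Rightarrow> fm \<Rightarrow> fm" where
  "bind k x Falsity = Falsity"
| "bind k x (Pred p ts) = Pred p (map (bind_tm k x) ts)"
| "bind k x (Eq t1 t2) = Eq (bind_tm k x t1) (bind_tm k x t2)"
| "bind k x (Neg A) = Neg (bind k x A)"
| "bind k x (And A1 A2) = And (bind k x A1) (bind k x A2)"
| "bind k x (Or A1 A2) = Or (bind k x A1) (bind k x A2)"
| "bind k x (Imp A1 A2) = Imp (bind k x A1) (bind k x A2)"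
| "bind k x (AllB A) = AllB (bind (Suc k) x A)"
| "bind k x (ExB A) = ExB (bind (Suc k) x A)"

definition Forall :: "var \<Rightarrow> fm \<Rightarrow> fm" where
  "Forall x A = AllB (bind 0 x A)"

definition Exists :: "var \<Rightarrow> fm \<Rightarrow> fm" where
  "Exists x A = ExB (bind 0 x A)"

inductive_set Terms :: "signat \<Rightarrow> tm set" for \<Sigma> :: signat where
  "Var x \<in> Terms \<Sigma>"
| "\<lbrakk> FunS f \<in> \<Sigma>; length ts = farity f; \<And>t. t \<in> set ts \<Longrightarrow> t \<in> Terms \<Sigma> \<rbrakk> \<Longrightarrow> Fn f ts \<in> Terms \<Sigma>"

inductive_set LP :: "signat \<Rightarrow> fm set" for \<Sigma> :: signat where
  "Falsity \<in> LP \<Sigma>"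
| "\<lbrakk> PredS p \<in> \<Sigma>; length ts = parity p; \<And>t. t \<in> set ts \<Longrightarrow> t \<in> Terms \<Sigma> \<rbrakk> \<Longrightarrow> Pred p ts \<in> LP \<Sigma>"
| "\<lbrakk> t1 \<in> Terms \<Sigma>; t2 \<in> Terms \<Sigma> \<rbrakk> \<Longrightarrow> Eq t1 t2 \<in> LP \<Sigma>"
| "A \<in> LP \<Sigma> \<Longrightarrow> Neg A \<in> LP \<Sigma>"
| "\<lbrakk> A1 \<in> LP \<Sigma>; A2 \<in> LP \<Sigma> \<rbrakk> \<Longrightarrow> And A1 A2 \<in> LP \<Sigma>"
| "\<lbrakk> A1 \<in> LP \<Sigma>; A2 \<in> LP \<Sigma> \<rbrakk> \<Longrightarrow> Or A1 A2 \<in> LP \<Sigma>"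
| "\<lbrakk> A1 \<in> LP \<Sigma>; A2 \<in> LP \<Sigma> \<rbrakk> \<Longrightarrow> Imp A1 A2 \<in> LP \<Sigma>"
| "A \<in> LP \<Sigma> \<Longrightarrow> Forall x A \<in> LP \<Sigma>"
| "A \<in> LP \<Sigma> \<Longrightarrow> Exists x A \<in> LP \<Sigma>"


section \<open>Semantics\<close>

datatype tval = TT | FF | BB

record 'u struct =
  univ :: "'u set"
  fint :: "fsym \<Rightarrow> 'u list \<Rightarrow> 'u"
  pint :: "psym \<Rightarrow> 'u list \<Rightarrow> tval"
  eqint :: "'u \<Rightarrow> 'u \<Rightarrow> tval"

text \<open>
  The last conjunct makes the designated part of \<open>eqint\<close> the identity of the domain. It is
  needed for soundness of the elimination rule for \<open>=\<close>: with only \<open>eqint d d \<in> {TT, BB}\<close> the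
  provable sequent \<open>x = y \<turnstile> y = x\<close> fails for \<open>eqint 0 1 = TT\<close>, \<open>eqint 1 0 = FF\<close>.
\<close>

definition is_struct :: "signat \<Rightarrow> 'u struct \<Rightarrow> bool" where
  "is_struct \<Sigma> M \<longleftrightarrow>
     univ M \<noteq> {} \<and>
     (\<forall>f ds. FunS f \<in> \<Sigma> \<and> length ds = farity f \<and> set ds \<subseteq> univ M \<longrightarrow> fint M f ds \<in> univ M) \<and>
     (\<forall>d\<in>univ M. eqint M d d \<in> {TT, BB}) \<and>
     (\<forall>d\<in>univ M. \<forall>d'\<in>univ M. d \<noteq> d' \<longrightarrow> eqint M d d' = FF)"

definition is_assignment :: "'u struct \<Rightarrow> (var \<Rightarrow> 'u) \<Rightarrow> bool" where
  "is_assignment M \<alpha> \<longleftrightarrow> (\<forall>x. \<alpha> x \<in> univ M)"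

text \<open>The list \<open>e\<close> holds the values of the bound variables, innermost quantifier first.\<close>

primrec val_tm :: "'u struct \<Rightarrow> 'u list \<Rightarrow> (var \<Rightarrow> 'u) \<Rightarrow> tm \<Rightarrow> 'u" where
  "val_tm M e \<alpha> (Var x) = \<alpha> x"
| "val_tm M e \<alpha> (Bound i) = e ! i"
| "val_tm M e \<alpha> (Fn f ts) = fint M f (map (val_tm M e \<alpha>) ts)"

primrec val_fm :: "'u struct \<Rightarrow> 'u list \<Rightarrow> (var \<Rightarrow> 'u) \<Rightarrow> fm \<Rightarrow> tval" where
  "val_fm M e \<alpha> Falsity = FF"
| "val_fm M e \<alpha> (Pred p ts) = pint M p (map (val_tm M e \<alpha>) ts)"
| "val_fm M e \<alpha> (Eq t1 t2) = eqint M (val_tm M e \<alpha> t1) (val_tm M e \<alpha> t2)"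
| "val_fm M e \<alpha> (Neg A) =
     (if val_fm M e \<alpha> A = FF then TT else if val_fm M e \<alpha> A = TT then FF else BB)"
| "val_fm M e \<alpha> (And A1 A2) =
     (if val_fm M e \<alpha> A1 = TT \<and> val_fm M e \<alpha> A2 = TT then TT
      else if val_fm M e \<alpha> A1 = FF \<or> val_fm M e \<alpha> A2 = FF then FF else BB)"
| "val_fm M e \<alpha> (Or A1 A2) =
     (if val_fm M e \<alpha> A1 = TT \<or> val_fm M e \<alpha> A2 = TT then TT
      else if val_fm M e \<alpha> A1 = FF \<and> val_fm M e \<alpha> A2 = FF then FF else BB)"
| "val_fm M e \<alpha> (Imp A1 A2) =
     (if val_fm M e \<alpha> A1 = FF \<or> val_fm M e \<alpha> A2 = TT then TT
      else if val_fm M e \<alpha> A1 \<noteq> FF \<and> val_fm M e \<alpha> A2 = FF then FF else BB)"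
| "val_fm M e \<alpha> (AllB A) =
     (if \<forall>d\<in>univ M. val_fm M (d # e) \<alpha> A = TT then TT
      else if \<exists>d\<in>univ M. val_fm M (d # e) \<alpha> A = FF then FF else BB)"
| "val_fm M e \<alpha> (ExB A) =
     (if \<exists>d\<in>univ M. val_fm M (d # e) \<alpha> A = TT then TT
      else if \<forall>d\<in>univ M. val_fm M (d # e) \<alpha> A = FF then FF else BB)"

definition valuation :: "'u struct \<Rightarrow> (var \<Rightarrow> 'u) \<Rightarrow> fm \<Rightarrow> tval" where
  "valuation M \<alpha> A = val_fm M [] \<alpha> A"

text \<open>
  Logical consequence over all structures whose domain is a nonempty subset of the type \<open>'u\<close>.
  HOL cannot quantify over types inside a formula, hence the type argument.
\<close>

definition entails :: "'u itself \<Rightarrow> signat \<Rightarrow> fm set \<Rightarrow> fm \<Rightarrow> bool" where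
  "entails _ \<Sigma> \<Gamma> A \<longleftrightarrow>
     (\<forall>(M :: 'u struct) \<alpha>. is_struct \<Sigma> M \<and> is_assignment M \<alpha> \<longrightarrow>
        (\<exists>A'\<in>\<Gamma>. valuation M \<alpha> A' = FF) \<or> valuation M \<alpha> A \<in> {TT, BB})"


section \<open>Proof system\<close>

datatype sequent = Sequent "fm set" fm  (infix \<open>\<turnstile>\<close> 45)

primrec is_sequent :: "signat \<Rightarrow> sequent \<Rightarrow> bool" where
  "is_sequent \<Sigma> (\<Gamma> \<turnstile> A) \<longleftrightarrow> finite \<Gamma> \<and> \<Gamma> \<subseteq> LP \<Sigma> \<and> A \<in> LP \<Sigma>"

text \<open>\<open>rule_inst \<Sigma> Ps S\<close>: from the premises \<open>Ps\<close> infer \<open>S\<close>.\<close>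

inductive rule_inst :: "signat \<Rightarrow> sequent list \<Rightarrow> sequent \<Rightarrow> bool" for \<Sigma> :: signat where
  Id: "rule_inst \<Sigma> [] (insert A \<Gamma> \<turnstile> A)"
| TI: "rule_inst \<Sigma> [] (\<Gamma> \<turnstile> Neg Falsity)"
| EM: "rule_inst \<Sigma> [] (\<Gamma> \<turnstile> Or A (Neg A))"
| FE: "rule_inst \<Sigma> [\<Gamma> \<turnstile> Falsity] (\<Gamma> \<turnstile> A)"
| AndI: "rule_inst \<Sigma> [\<Gamma> \<turnstile> A1, \<Gamma> \<turnstile> A2] (\<Gamma> \<turnstile> And A1 A2)"
| AndE1: "rule_inst \<Sigma> [\<Gamma> \<turnstile> And A1 A2] (\<Gamma> \<turnstile> A1)"
| AndE2: "rule_inst \<Sigma> [\<Gamma> \<turnstile> And A1 A2] (\<Gamma> \<turnstile> A2)"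
| OrI1: "rule_inst \<Sigma> [\<Gamma> \<turnstile> A1] (\<Gamma> \<turnstile> Or A1 A2)"
| OrI2: "rule_inst \<Sigma> [\<Gamma> \<turnstile> A2] (\<Gamma> \<turnstile> Or A1 A2)"
| OrE: "rule_inst \<Sigma> [\<Gamma> \<turnstile> Or A1 A2, insert A1 \<Gamma> \<turnstile> A3, insert A2 \<Gamma> \<turnstile> A3] (\<Gamma> \<turnstile> A3)"
| ImpI: "rule_inst \<Sigma> [insert A1 \<Gamma> \<turnstile> A2] (\<Gamma> \<turnstile> Imp A1 A2)"
| ImpE: "rule_inst \<Sigma> [\<Gamma> \<turnstile> Imp A1 A2, \<Gamma> \<turnstile> A1] (\<Gamma> \<turnstile> A2)"
| AllI: "\<lbrakk> A \<in> LP \<Sigma>; x \<notin> free_set \<Gamma> \<rbrakk> \<Longrightarrow> rule_inst \<Sigma> [\<Gamma> \<turnstile> A] (\<Gamma> \<turnstile> Forall x A)"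
| AllE: "\<lbrakk> A \<in> LP \<Sigma>; t \<in> Terms \<Sigma> \<rbrakk> \<Longrightarrow> rule_inst \<Sigma> [\<Gamma> \<turnstile> Forall x A] (\<Gamma> \<turnstile> subst x t A)"
| ExI: "\<lbrakk> A \<in> LP \<Sigma>; t \<in> Terms \<Sigma> \<rbrakk> \<Longrightarrow> rule_inst \<Sigma> [\<Gamma> \<turnstile> subst x t A] (\<Gamma> \<turnstile> Exists x A)"
| ExE: "\<lbrakk> A1 \<in> LP \<Sigma>; x \<notin> free_set (\<Gamma> \<union> {A2}) \<rbrakk> \<Longrightarrow>
    rule_inst \<Sigma> [\<Gamma> \<turnstile> Exists x A1, insert A1 \<Gamma> \<turnstile> A2] (\<Gamma> \<turnstile> A2)"
| EqI: "t \<in> Terms \<Sigma> \<Longrightarrow> rule_inst \<Sigma> [] (\<Gamma> \<turnstile> Eq t t)"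
| EqE: "\<lbrakk> A \<in> LP \<Sigma>; t1 \<in> Terms \<Sigma>; t2 \<in> Terms \<Sigma> \<rbrakk> \<Longrightarrow>
    rule_inst \<Sigma> [\<Gamma> \<turnstile> Eq t1 t2, \<Gamma> \<turnstile> subst x t1 A] (\<Gamma> \<turnstile> subst x t2 A)"
| NegNeg1: "rule_inst \<Sigma> [\<Gamma> \<turnstile> Neg (Neg A)] (\<Gamma> \<turnstile> A)"
| NegNeg2: "rule_inst \<Sigma> [\<Gamma> \<turnstile> A] (\<Gamma> \<turnstile> Neg (Neg A))"
| NegAnd1: "rule_inst \<Sigma> [\<Gamma> \<turnstile> Neg (And A1 A2)] (\<Gamma> \<turnstile> Or (Neg A1) (Neg A2))"
| NegAnd2: "rule_inst \<Sigma> [\<Gamma> \<turnstile> Or (Neg A1) (Neg A2)] (\<Gamma> \<turnstile> Neg (And A1 A2))"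
| NegOr1: "rule_inst \<Sigma> [\<Gamma> \<turnstile> Neg (Or A1 A2)] (\<Gamma> \<turnstile> And (Neg A1) (Neg A2))"
| NegOr2: "rule_inst \<Sigma> [\<Gamma> \<turnstile> And (Neg A1) (Neg A2)] (\<Gamma> \<turnstile> Neg (Or A1 A2))"
| NegImp1: "rule_inst \<Sigma> [\<Gamma> \<turnstile> Neg (Imp A1 A2)] (\<Gamma> \<turnstile> And A1 (Neg A2))"
| NegImp2: "rule_inst \<Sigma> [\<Gamma> \<turnstile> And A1 (Neg A2)] (\<Gamma> \<turnstile> Neg (Imp A1 A2))"
| NegAll1: "A \<in> LP \<Sigma> \<Longrightarrow> rule_inst \<Sigma> [\<Gamma> \<turnstile> Neg (Forall x A)] (\<Gamma> \<turnstile> Exists x (Neg A))"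
| NegAll2: "A \<in> LP \<Sigma> \<Longrightarrow> rule_inst \<Sigma> [\<Gamma> \<turnstile> Exists x (Neg A)] (\<Gamma> \<turnstile> Neg (Forall x A))"
| NegEx1: "A \<in> LP \<Sigma> \<Longrightarrow> rule_inst \<Sigma> [\<Gamma> \<turnstile> Neg (Exists x A)] (\<Gamma> \<turnstile> Forall x (Neg A))"
| NegEx2: "A \<in> LP \<Sigma> \<Longrightarrow> rule_inst \<Sigma> [\<Gamma> \<turnstile> Forall x (Neg A)] (\<Gamma> \<turnstile> Neg (Exists x A))"

definition is_proof :: "signat \<Rightarrow> sequent list \<Rightarrow> bool" where
  "is_proof \<Sigma> \<pi> \<longleftrightarrow>
     (\<forall>i<length \<pi>. is_sequent \<Sigma> (\<pi> ! i) \<and>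
        (\<exists>Ps. rule_inst \<Sigma> Ps (\<pi> ! i) \<and> set Ps \<subseteq> set (take i \<pi>)))"

definition provable :: "signat \<Rightarrow> sequent \<Rightarrow> bool" where
  "provable \<Sigma> S \<longleftrightarrow> (\<exists>\<pi>. is_proof \<Sigma> \<pi> \<and> \<pi> \<noteq> [] \<and> last \<pi> = S)"


section \<open>Adequacy of the binding representation\<close>

fun closed_tm :: "nat \<Rightarrow> tm \<Rightarrow> bool" where
  "closed_tm k (Var x) = True"
| "closed_tm k (Bound i) = (i < k)"
| "closed_tm k (Fn f ts) = (\<forall>t\<in>set ts. closed_tm k t)"

primrec closed_fm :: "nat \<Rightarrow> fm \<Rightarrow> bool" where
  "closed_fm k Falsity = True"
| "closed_fm k (Pred p ts) = (\<forall>t\<in>set ts. closed_tm k t)"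
| "closed_fm k (Eq t1 t2) = (closed_tm k t1 \<and> closed_tm k t2)"
| "closed_fm k (Neg A) = closed_fm k A"
| "closed_fm k (And A1 A2) = (closed_fm k A1 \<and> closed_fm k A2)"
| "closed_fm k (Or A1 A2) = (closed_fm k A1 \<and> closed_fm k A2)"
| "closed_fm k (Imp A1 A2) = (closed_fm k A1 \<and> closed_fm k A2)"
| "closed_fm k (AllB A) = closed_fm (Suc k) A"
| "closed_fm k (ExB A) = closed_fm (Suc k) A"

lemma closed_bind_tm: "closed_tm k t \<Longrightarrow> closed_tm (Suc k) (bind_tm k x t)"
  by (induction t) auto

lemma closed_bind: "closed_fm k A \<Longrightarrow> closed_fm (Suc k) (bind k x A)"
  by (induction A arbitrary: k) (auto simp: closed_bind_tm)

lemma closed_Terms: "t \<in> Terms \<Sigma> \<Longrightarrow> closed_tm k t"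
  by (induction rule: Terms.induct) auto

lemma closed_LP: "A \<in> LP \<Sigma> \<Longrightarrow> closed_fm 0 A"
  by (induction rule: LP.induct)
    (auto simp: Forall_def Exists_def intro!: closed_bind intro: closed_Terms)

lemma free_bind_tm: "free_tm (bind_tm k x t) = free_tm t - {x}"
  by (induction t) auto

lemma free_bind: "free (bind k x A) = free A - {x}"
  by (induction A arbitrary: k) (auto simp: free_bind_tm)

lemma free_Forall: "free (Forall x A) = free A - {x}"
  and free_Exists: "free (Exists x A) = free A - {x}"
  by (simp_all add: Forall_def Exists_def free_bind)

lemma bind_rename_tm: "y \<notin> free_tm t \<Longrightarrow> bind_tm k y (subst_tm x (Var y) t) = bind_tm k x t"
  by (induction t) auto

lemma bind_rename: "y \<notin> free A \<Longrightarrow> bind k y (subst x (Var y) A) = bind k x A"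
  by (induction A arbitrary: k) (auto simp: bind_rename_tm)

lemma Forall_rename: "y \<notin> free A \<Longrightarrow> Forall y (subst x (Var y) A) = Forall x A"
  and Exists_rename: "y \<notin> free A \<Longrightarrow> Exists y (subst x (Var y) A) = Exists x A"
  by (simp_all add: Forall_def Exists_def bind_rename)

lemma bind_inject_tm:
  "\<lbrakk> closed_tm k s; closed_tm k t; bind_tm k x s = bind_tm k x t \<rbrakk> \<Longrightarrow> s = t"
proof (induction s arbitrary: t)
  case (Fn f ss)
  then obtain ts where t: "t = Fn f ts" and m: "map (bind_tm k x) ss = map (bind_tm k x) ts"
    by (cases t) (auto split: if_splits)
  have "ss = ts"
  proof (rule nth_equalityI)
    show l: "length ss = length ts" using m by (metis length_map)
    fix i assume "i < length ss"
    then show "ss ! i = ts ! i"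
      using Fn l m t by (metis closed_tm.simps(3) nth_map nth_mem)
  qed
  then show ?case using t by simp
qed (case_tac t; auto split: if_splits)+

lemma bind_inject_tms:
  assumes "\<forall>t\<in>set ss. closed_tm k t" "\<forall>t\<in>set ts. closed_tm k t"
    "map (bind_tm k x) ss = map (bind_tm k x) ts"
  shows "ss = ts"
  using bind_inject_tm[of k "Fn f ss" "Fn f ts" x for f] assms by simp

lemma bind_inject:
  "\<lbrakk> closed_fm k A; closed_fm k B; bind k x A = bind k x B \<rbrakk> \<Longrightarrow> A = B"
  by (induction A arbitrary: k B; case_tac B)
    (auto dest: bind_inject_tm bind_inject_tms)

lemma Forall_inject: "\<lbrakk> A \<in> LP \<Sigma>; B \<in> LP \<Sigma>; Forall x A = Forall x B \<rbrakk> \<Longrightarrow> A = B"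
  and Exists_inject: "\<lbrakk> A \<in> LP \<Sigma>; B \<in> LP \<Sigma>; Exists x A = Exists x B \<rbrakk> \<Longrightarrow> A = B"
  by (auto simp: Forall_def Exists_def dest: closed_LP bind_inject)

lemma bind_subst_tm:
  "\<lbrakk> y \<noteq> x; y \<notin> free_tm t \<rbrakk> \<Longrightarrow> subst_tm x t (bind_tm k y s) = bind_tm k y (subst_tm x t s)"
proof (induction s)
  case (Var z)
  have "y \<notin> free_tm u \<Longrightarrow> bind_tm k y u = u" for u
    by (induction u) (auto simp: map_idI)
  then show ?case using Var by auto
qed auto

lemma bind_subst:
  "\<lbrakk> y \<noteq> x; y \<notin> free_tm t \<rbrakk> \<Longrightarrow> subst x t (bind k y A) = bind k y (subst x t A)"
  by (induction A arbitrary: k) (auto simp: bind_subst_tm)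

lemma subst_fresh_tm: "x \<notin> free_tm s \<Longrightarrow> subst_tm x t s = s"
  by (induction s) (auto simp: map_idI)

lemma subst_fresh: "x \<notin> free A \<Longrightarrow> subst x t A = A"
  by (induction A) (auto simp: subst_fresh_tm map_idI)

lemma subst_Forall:
    "\<lbrakk> y \<noteq> x; y \<notin> free_tm t \<rbrakk> \<Longrightarrow> subst x t (Forall y A) = Forall y (subst x t A)"
  and subst_Exists:
    "\<lbrakk> y \<noteq> x; y \<notin> free_tm t \<rbrakk> \<Longrightarrow> subst x t (Exists y A) = Exists y (subst x t A)"
  by (simp_all add: Forall_def Exists_def bind_subst)

lemma subst_Forall_same: "subst x t (Forall x A) = Forall x A"
  and subst_Exists_same: "subst x t (Exists x A) = Exists x A"
  by (simp_all add: subst_fresh free_Forall free_Exists)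

lemma val_bind_tm:
  "closed_tm (length e) t \<Longrightarrow>
   val_tm M (e @ [d]) \<alpha> (bind_tm (length e) x t) = val_tm M e (\<alpha>(x := d)) t"
  by (induction t) (auto simp: nth_append fun_upd_def intro!: arg_cong[where f = "fint M _"])

lemma val_bind_tms:
  assumes "\<forall>t\<in>set ts. closed_tm (length e) t"
  shows "map (val_tm M (e @ [d]) \<alpha> \<circ> bind_tm (length e) x) ts = map (val_tm M e (\<alpha>(x := d))) ts"
  using assms by (intro map_cong) (simp_all add: val_bind_tm)

lemma val_bind:
  "closed_fm (length e) A \<Longrightarrow>
   val_fm M (e @ [d]) \<alpha> (bind (length e) x A) = val_fm M e (\<alpha>(x := d)) A"
proof (induction A arbitrary: e)
  case (AllB A)
  from AllB.IH[of "_ # e"] AllB.prems show ?case by simp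
next
  case (ExB A)
  from ExB.IH[of "_ # e"] ExB.prems show ?case by simp
qed (simp_all add: val_bind_tm val_bind_tms)

lemma valuation_Forall:
  assumes "A \<in> LP \<Sigma>"
  shows "valuation M \<alpha> (Forall x A) =
    (if \<forall>d\<in>univ M. valuation M (\<alpha>(x := d)) A = TT then TT
     else if \<exists>d\<in>univ M. valuation M (\<alpha>(x := d)) A = FF then FF else BB)"
  using closed_LP[OF assms] by (simp add: valuation_def Forall_def val_bind[of "[]", simplified])

lemma valuation_Exists:
  assumes "A \<in> LP \<Sigma>"
  shows "valuation M \<alpha> (Exists x A) =
    (if \<exists>d\<in>univ M. valuation M (\<alpha>(x := d)) A = TT then TT
     else if \<forall>d\<in>univ M. valuation M (\<alpha>(x := d)) A = FF then FF else BB)"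
  using closed_LP[OF assms] by (simp add: valuation_def Exists_def val_bind[of "[]", simplified])

end

theory Submission
  imports Defs "HOL-Library.Countable"
begin

text \<open>
  Completeness is a Henkin argument. The formula \<open>A \<supset> F\<close> is a classical negation: excluded middle
  for \<open>A \<supset> F\<close> together with the rule for \<open>\<not>(A \<supset> F)\<close> yields reductio ad absurdum. So if \<open>\<Gamma> \<turnstile> A\<close> is
  unprovable, \<open>\<Gamma>, A \<supset> F\<close> extends to a maximal consistent set \<open>\<Delta>\<close> with witnesses. In the term model of
  \<open>\<Delta>\<close> an atom is \<open>f\<close>, \<open>t\<close> or \<open>b\<close> according to which of it and its negation belong to \<open>\<Delta>\<close>, and one
  proves simultaneously that a formula is not \<open>f\<close> iff it is in \<open>\<Delta>\<close>, and not \<open>t\<close> iff its negation is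
  in \<open>\<Delta>\<close>. Since terms are countable, the model lives in any infinite type.
\<close>

subsection \<open>Syntax\<close>

lemma finite_free_tm: "finite (free_tm t)"
  by (induction t) auto

lemma finite_free: "finite (free A)"
  by (induction A) (auto simp: finite_free_tm)

lemma finite_free_set: "finite \<Gamma> \<Longrightarrow> finite (free_set \<Gamma>)"
  by (simp add: free_set_def finite_free)

lemma ex_fresh_var: "finite V \<Longrightarrow> \<exists>y::var. y \<notin> V"
  by (rule ex_new_if_finite) simp_all

text \<open>The quantifier clauses of \<open>LP\<close> are not constructor patterns, so inversion
  must unfold \<open>Forall\<close> and \<open>Exists\<close> to see that their heads differ from
  \<open>Neg\<close>. The next four lemmas work alike.\<close>

lemma Neg_LP_iff: "Neg A \<in> LP \<Sigma> \<longleftrightarrow> A \<in> LP \<Sigma>"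
  by (auto elim: LP.cases simp: Forall_def Exists_def intro: LP.intros)

lemma And_LP_iff: "And A B \<in> LP \<Sigma> \<longleftrightarrow> A \<in> LP \<Sigma> \<and> B \<in> LP \<Sigma>"
  by (auto elim: LP.cases simp: Forall_def Exists_def intro: LP.intros)

lemma Or_LP_iff: "Or A B \<in> LP \<Sigma> \<longleftrightarrow> A \<in> LP \<Sigma> \<and> B \<in> LP \<Sigma>"
  by (auto elim: LP.cases simp: Forall_def Exists_def intro: LP.intros)

lemma Imp_LP_iff: "Imp A B \<in> LP \<Sigma> \<longleftrightarrow> A \<in> LP \<Sigma> \<and> B \<in> LP \<Sigma>"
  by (auto elim: LP.cases simp: Forall_def Exists_def intro: LP.intros)

lemma Eq_LP_iff: "Eq s t \<in> LP \<Sigma> \<longleftrightarrow> s \<in> Terms \<Sigma> \<and> t \<in> Terms \<Sigma>"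
  by (auto elim: LP.cases simp: Forall_def Exists_def intro: LP.intros)

lemmas LP_iffs = LP.intros(1) Neg_LP_iff And_LP_iff Or_LP_iff Imp_LP_iff Eq_LP_iff

lemma subst_tm_Terms: "\<lbrakk> s \<in> Terms \<Sigma>; t \<in> Terms \<Sigma> \<rbrakk> \<Longrightarrow> subst_tm x t s \<in> Terms \<Sigma>"
  by (induction rule: Terms.induct) (auto intro!: Terms.intros)

text \<open>Unlike the built-in size, \<open>fsize\<close> ignores terms and is therefore invariant under substitution.\<close>

primrec fsize :: "fm \<Rightarrow> nat" where
  "fsize Falsity = 0"
| "fsize (Pred p ts) = 0"
| "fsize (Eq t1 t2) = 0"
| "fsize (Neg A) = Suc (fsize A)"
| "fsize (And A B) = Suc (fsize A + fsize B)"
| "fsize (Or A B) = Suc (fsize A + fsize B)"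
| "fsize (Imp A B) = Suc (fsize A + fsize B)"
| "fsize (AllB A) = Suc (fsize A)"
| "fsize (ExB A) = Suc (fsize A)"

lemma fsize_subst [simp]: "fsize (subst x t A) = fsize A"
  by (induction A) auto

lemma fsize_bind [simp]: "fsize (bind k x A) = fsize A"
  by (induction A arbitrary: k) auto

lemma fsize_Forall [simp]: "fsize (Forall x A) = Suc (fsize A)"
  and fsize_Exists [simp]: "fsize (Exists x A) = Suc (fsize A)"
  by (simp_all add: Forall_def Exists_def)

text \<open>A bound variable may be \<open>x\<close> or occur in \<open>t\<close>, and then
  \<open>subst\<close> does not commute with the quantifier. Such a variable is renamed first. The
  renamed body is no subformula of \<open>A\<close>, but it has the same \<open>fsize\<close> as the
  old body, so the induction hypothesis serves twice: for renaming and for substituting.\<close>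

lemma subst_LP:
  "\<lbrakk> A \<in> LP \<Sigma>; t \<in> Terms \<Sigma> \<rbrakk> \<Longrightarrow> subst x t A \<in> LP \<Sigma>"
proof (induction "fsize A" arbitrary: A x t rule: less_induct)
  case less
  have ren: "\<exists>z C. C \<in> LP \<Sigma> \<and> fsize C = fsize B \<and> Forall y B = Forall z C \<and>
      Exists y B = Exists z C \<and> z \<noteq> x \<and> z \<notin> free_tm t"
    if B: "B \<in> LP \<Sigma>" "fsize B < fsize A" for y B
  proof -
    obtain z where z: "z \<notin> free B \<union> free_tm t \<union> {x}"
      using ex_fresh_var[of "free B \<union> free_tm t \<union> {x}"] by (auto simp: finite_free finite_free_tm)
    have "subst y (Var z) B \<in> LP \<Sigma>"
      using less.hyps[OF B(2,1)] by (simp add: Terms.intros)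
    then show ?thesis
      using z by (intro exI[of _ z] exI[of _ "subst y (Var z) B"])
        (simp add: Forall_rename Exists_rename)
  qed
  from less.prems(1) show ?case
  proof cases
    case (2 p ts)
    then show ?thesis using less.prems(2) subst_tm_Terms by (auto intro!: LP.intros(2))
  next
    case (8 B y)
    obtain z C where C: "C \<in> LP \<Sigma>" "fsize C = fsize B" "Forall y B = Forall z C"
      "z \<noteq> x" "z \<notin> free_tm t"
      using ren[of B y] 8 by auto
    then have "subst x t C \<in> LP \<Sigma>"
      using less.hyps[of C] less.prems(2) 8 by simp
    then show ?thesis
      using C 8 by (simp add: subst_Forall LP.intros)
  next
    case (9 B y)
    obtain z C where C: "C \<in> LP \<Sigma>" "fsize C = fsize B" "Exists y B = Exists z C"
      "z \<noteq> x" "z \<notin> free_tm t"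
      using ren[of B y] 9 by auto
    then have "subst x t C \<in> LP \<Sigma>"
      using less.hyps[of C] less.prems(2) 9 by simp
    then show ?thesis
      using C 9 by (simp add: subst_Exists LP.intros)
  qed (use less in \<open>auto intro!: LP.intros intro: subst_tm_Terms\<close>)
qed

lemma subst_LP_Var: "A \<in> LP \<Sigma> \<Longrightarrow> subst x (Var y) A \<in> LP \<Sigma>"
  by (simp add: subst_LP Terms.intros)

subsection \<open>Semantics\<close>

lemma val_tm_coincidence:
  "\<forall>x\<in>free_tm t. \<alpha> x = \<beta> x \<Longrightarrow> val_tm M e \<alpha> t = val_tm M e \<beta> t"
  by (induction t) (auto intro!: arg_cong[where f = "fint M _"])

lemma val_fm_coincidence:
  "\<forall>x\<in>free A. \<alpha> x = \<beta> x \<Longrightarrow> val_fm M e \<alpha> A = val_fm M e \<beta> A"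
proof (induction A arbitrary: e)
  case (Pred p ts)
  then have "map (val_tm M e \<alpha>) ts = map (val_tm M e \<beta>) ts"
    by (auto intro: val_tm_coincidence)
  then show ?case by (simp del: map_eq_conv)
next
  case (Eq t1 t2)
  then have "val_tm M e \<alpha> t1 = val_tm M e \<beta> t1" "val_tm M e \<alpha> t2 = val_tm M e \<beta> t2"
    by (auto intro: val_tm_coincidence)
  then show ?case by simp
next
  case (And A B)
  then have "val_fm M e \<alpha> A = val_fm M e \<beta> A" "val_fm M e \<alpha> B = val_fm M e \<beta> B" by auto
  then show ?case by simp
next
  case (Or A B)
  then have "val_fm M e \<alpha> A = val_fm M e \<beta> A" "val_fm M e \<alpha> B = val_fm M e \<beta> B" by auto
  then show ?case by simp
next
  case (Imp A B)
  then have "val_fm M e \<alpha> A = val_fm M e \<beta> A" "val_fm M e \<alpha> B = val_fm M e \<beta> B" by auto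
  then show ?case by simp
next
  case (Neg A)
  then have "val_fm M e \<alpha> A = val_fm M e \<beta> A" by auto
  then show ?case by simp
next
  case (AllB A)
  then have "val_fm M (d # e) \<alpha> A = val_fm M (d # e) \<beta> A" for d by auto
  then show ?case by simp
next
  case (ExB A)
  then have "val_fm M (d # e) \<alpha> A = val_fm M (d # e) \<beta> A" for d by auto
  then show ?case by simp
qed simp

lemma valuation_fun_upd_fresh: "x \<notin> free A \<Longrightarrow> valuation M (\<alpha>(x := d)) A = valuation M \<alpha> A"
  unfolding valuation_def by (rule val_fm_coincidence) auto

text \<open>Under quantifiers the substituted term is evaluated with a nonempty list
  \<open>e\<close>, whereas the updated assignment in \<open>val_subst\<close> evaluates it with the
  empty list.\<close>

lemma val_tm_closed: "closed_tm 0 t \<Longrightarrow> val_tm M e \<alpha> t = val_tm M [] \<alpha> t"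
  by (induction t) (auto intro!: arg_cong[where f = "fint M _"])

lemma val_subst_tm:
  "closed_tm 0 t \<Longrightarrow> val_tm M e \<alpha> (subst_tm x t s) = val_tm M e (\<alpha>(x := val_tm M [] \<alpha> t)) s"
proof (induction s)
  case (Var y)
  then show ?case using val_tm_closed[of t M e \<alpha>] by simp
next
  case (Fn f ts)
  then have "map (val_tm M e \<alpha>) (map (subst_tm x t) ts) =
      map (val_tm M e (\<alpha>(x := val_tm M [] \<alpha> t))) ts"
    by (simp add: fun_upd_def)
  then show ?case by (simp only: subst_tm.simps val_tm.simps)
qed simp

lemma val_subst:
  "closed_tm 0 t \<Longrightarrow> val_fm M e \<alpha> (subst x t A) = val_fm M e (\<alpha>(x := val_tm M [] \<alpha> t)) A"
proof (induction A arbitrary: e)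
  case (Pred p ts)
  then have "map (val_tm M e \<alpha>) (map (subst_tm x t) ts) =
      map (val_tm M e (\<alpha>(x := val_tm M [] \<alpha> t))) ts"
    by (simp add: val_subst_tm)
  then show ?case by (simp only: subst.simps val_fm.simps)
qed (simp_all add: val_subst_tm)

lemma valuation_subst:
  "t \<in> Terms \<Sigma> \<Longrightarrow> valuation M \<alpha> (subst x t A) = valuation M (\<alpha>(x := val_tm M [] \<alpha> t)) A"
  by (simp add: valuation_def val_subst closed_Terms)

lemma val_tm_univ:
  assumes "is_struct \<Sigma> M" "is_assignment M \<alpha>"
  shows "t \<in> Terms \<Sigma> \<Longrightarrow> val_tm M [] \<alpha> t \<in> univ M"
proof (induction rule: Terms.induct)
  case (2 f ts)
  then have "set (map (val_tm M [] \<alpha>) ts) \<subseteq> univ M" by auto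
  then show ?case using 2 assms by (simp add: is_struct_def)
qed (use assms in \<open>simp add: is_assignment_def\<close>)

text \<open>A formula is true (at least) when its value is not \<open>FF\<close> and false (at least) when its
  value is not \<open>TT\<close>; in these terms all clauses of the valuation become two-valued.\<close>

definition verifies :: "'u struct \<Rightarrow> (var \<Rightarrow> 'u) \<Rightarrow> fm \<Rightarrow> bool" where
  "verifies M \<alpha> A \<longleftrightarrow> valuation M \<alpha> A \<noteq> FF"

definition falsifies :: "'u struct \<Rightarrow> (var \<Rightarrow> 'u) \<Rightarrow> fm \<Rightarrow> bool" where
  "falsifies M \<alpha> A \<longleftrightarrow> valuation M \<alpha> A \<noteq> TT"

lemma verifies_or_falsifies: "verifies M \<alpha> A \<or> falsifies M \<alpha> A"
  by (simp add: verifies_def falsifies_def)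

lemma verifies_simps [simp]:
  "\<not> verifies M \<alpha> Falsity"
  "verifies M \<alpha> (Neg A) \<longleftrightarrow> falsifies M \<alpha> A"
  "verifies M \<alpha> (And A B) \<longleftrightarrow> verifies M \<alpha> A \<and> verifies M \<alpha> B"
  "verifies M \<alpha> (Or A B) \<longleftrightarrow> verifies M \<alpha> A \<or> verifies M \<alpha> B"
  "verifies M \<alpha> (Imp A B) \<longleftrightarrow> (verifies M \<alpha> A \<longrightarrow> verifies M \<alpha> B)"
  by (auto simp: verifies_def falsifies_def valuation_def)

lemma falsifies_simps [simp]:
  "falsifies M \<alpha> Falsity"
  "falsifies M \<alpha> (Neg A) \<longleftrightarrow> verifies M \<alpha> A"
  "falsifies M \<alpha> (And A B) \<longleftrightarrow> falsifies M \<alpha> A \<or> falsifies M \<alpha> B"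
  "falsifies M \<alpha> (Or A B) \<longleftrightarrow> falsifies M \<alpha> A \<and> falsifies M \<alpha> B"
  "falsifies M \<alpha> (Imp A B) \<longleftrightarrow> verifies M \<alpha> A \<and> falsifies M \<alpha> B"
  by (auto simp: verifies_def falsifies_def valuation_def)

lemma quantifier_simps:
  assumes "A \<in> LP \<Sigma>" "univ M \<noteq> {}"
  shows "verifies M \<alpha> (Forall x A) \<longleftrightarrow> (\<forall>d\<in>univ M. verifies M (\<alpha>(x := d)) A)"
    and "falsifies M \<alpha> (Forall x A) \<longleftrightarrow> (\<exists>d\<in>univ M. falsifies M (\<alpha>(x := d)) A)"
    and "verifies M \<alpha> (Exists x A) \<longleftrightarrow> (\<exists>d\<in>univ M. verifies M (\<alpha>(x := d)) A)"
    and "falsifies M \<alpha> (Exists x A) \<longleftrightarrow> (\<forall>d\<in>univ M. falsifies M (\<alpha>(x := d)) A)"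
  using assms(2)
  by (auto simp: verifies_def falsifies_def valuation_Forall[OF assms(1)]
      valuation_Exists[OF assms(1)])

lemma verifies_subst:
  "t \<in> Terms \<Sigma> \<Longrightarrow> verifies M \<alpha> (subst x t A) \<longleftrightarrow> verifies M (\<alpha>(x := val_tm M [] \<alpha> t)) A"
  and falsifies_subst:
  "t \<in> Terms \<Sigma> \<Longrightarrow> falsifies M \<alpha> (subst x t A) \<longleftrightarrow> falsifies M (\<alpha>(x := val_tm M [] \<alpha> t)) A"
  by (simp_all add: verifies_def falsifies_def valuation_subst)

lemma verifies_fun_upd_fresh:
  "x \<notin> free A \<Longrightarrow> verifies M (\<alpha>(x := d)) A \<longleftrightarrow> verifies M \<alpha> A"
  by (simp add: verifies_def valuation_fun_upd_fresh)

text \<open>The designated values are exactly those other than \<open>FF\<close>, so consequence is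
  preservation of \<open>verifies\<close>.\<close>

lemma entails_iff_verifies:
  "entails TYPE('u) \<Sigma> \<Gamma> A \<longleftrightarrow>
     (\<forall>(M :: 'u struct) \<alpha>. is_struct \<Sigma> M \<and> is_assignment M \<alpha> \<and> (\<forall>B\<in>\<Gamma>. verifies M \<alpha> B) \<longrightarrow>
        verifies M \<alpha> A)"
proof -
  have "v \<in> {TT, BB} \<longleftrightarrow> v \<noteq> FF" for v by (cases v) auto
  then show ?thesis unfolding entails_def verifies_def by blast
qed

subsection \<open>Soundness\<close>

text \<open>Strong induction on the position in a proof list; it allows reasoning as if provability
  were defined inductively.\<close>

lemma provable_induct [consumes 1, case_names rule]:
  assumes "provable \<Sigma> S"
    and step: "\<And>Ps S. \<lbrakk> rule_inst \<Sigma> Ps S; \<And>P. P \<in> set Ps \<Longrightarrow> Q P \<rbrakk> \<Longrightarrow> Q S"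
  shows "Q S"
proof -
  from assms(1) obtain \<pi> where \<pi>: "is_proof \<Sigma> \<pi>" "\<pi> \<noteq> []" "last \<pi> = S"
    unfolding provable_def by blast
  have "Q (\<pi> ! i)" if "i < length \<pi>" for i
    using that
  proof (induction i rule: less_induct)
    case (less i)
    then obtain Ps where Ps: "rule_inst \<Sigma> Ps (\<pi> ! i)" "set Ps \<subseteq> set (take i \<pi>)"
      using \<pi>(1) unfolding is_proof_def by blast
    have "\<exists>j<i. P = \<pi> ! j" if "P \<in> set Ps" for P
      using that Ps(2) less.prems by (force simp: in_set_conv_nth)
    then have "Q P" if "P \<in> set Ps" for P
      using that less by (metis order.strict_trans)
    then show ?case using step Ps by blast
  qed
  then show ?thesis using \<pi> by (metis last_conv_nth diff_less length_greater_0_conv zero_less_one)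
qed

lemma rule_inst_sound:
  assumes "rule_inst \<Sigma> Ps (\<Gamma> \<turnstile> A)"
    and "\<And>\<Gamma> A. (\<Gamma> \<turnstile> A) \<in> set Ps \<Longrightarrow> entails TYPE('u) \<Sigma> \<Gamma> A"
  shows "entails TYPE('u) \<Sigma> \<Gamma> A"
  unfolding entails_iff_verifies
proof (intro allI impI, elim conjE)
  fix M :: "'u struct" and \<alpha>
  assume M: "is_struct \<Sigma> M" and \<alpha>: "is_assignment M \<alpha>" and \<Gamma>: "\<forall>B\<in>\<Gamma>. verifies M \<alpha> B"
  note val = val_tm_univ[OF M]
  have ne: "univ M \<noteq> {}" using M by (simp add: is_struct_def)
  note q = quantifier_simps[OF _ ne]
  have prem: "verifies M \<beta> B"
    if "(\<Delta> \<turnstile> B) \<in> set Ps" "is_assignment M \<beta>" "\<forall>B\<in>\<Delta>. verifies M \<beta> B" for \<Delta> B \<beta>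
    using assms(2)[OF that(1)] M that(2,3) unfolding entails_iff_verifies by blast
  have upd: "is_assignment M (\<alpha>(x := d))" if "d \<in> univ M" for x d
    using \<alpha> that by (simp add: is_assignment_def)
  \<comment> \<open>In a structure distinct elements have equality value \<open>FF\<close>, so a
    verified equation means identity of values. This is what makes \<open>EqE\<close> sound.\<close>
  have eq: "verifies M \<alpha> (Eq s t) \<longleftrightarrow> val_tm M [] \<alpha> s = val_tm M [] \<alpha> t"
    if "s \<in> Terms \<Sigma>" "t \<in> Terms \<Sigma>" for s t
  proof -
    have "val_tm M [] \<alpha> s \<in> univ M" "val_tm M [] \<alpha> t \<in> univ M" using val[OF \<alpha>] that by auto
    then show ?thesis
      using M unfolding verifies_def valuation_def is_struct_def val_fm.simps
      by (metis empty_iff insert_iff tval.distinct(2,6))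
  qed
  note prem' = prem[OF _ \<alpha>]
  \<comment> \<open>Serves the rules not treated separately below; their premises all keep the
    context \<Gamma>.\<close>
  have same: "\<forall>P\<in>set Ps. \<forall>B. P = (\<Gamma> \<turnstile> B) \<longrightarrow> verifies M \<alpha> B" using prem' \<Gamma> by blast
  from assms(1) show "verifies M \<alpha> A"
  proof cases
    case Id then show ?thesis using \<Gamma> by simp
  next
    case (EM B) then show ?thesis using verifies_or_falsifies by simp
  next
    case (OrE B C)
    then show ?thesis using prem'[of \<Gamma> "Or B C"] prem'[of "insert B \<Gamma>" A] prem'[of "insert C \<Gamma>" A] \<Gamma>
      by auto
  next
    case (ImpI B C)
    then show ?thesis using prem'[of "insert B \<Gamma>" C] \<Gamma> by auto
  next
    case (ImpE B)
    then show ?thesis using prem'[of \<Gamma> B] prem'[of \<Gamma> "Imp B A"] \<Gamma> by auto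
  next
    case (AllI B x)
    \<comment> \<open>The eigenvariable is not free in \<Gamma>, so the premise may be used at every
      value of \<open>x\<close>.\<close>
    then have "\<forall>C\<in>\<Gamma>. verifies M (\<alpha>(x := d)) C" for d
      using \<Gamma> by (auto simp: free_set_def verifies_fun_upd_fresh)
    then show ?thesis using prem[of \<Gamma> B] upd AllI by (simp add: q)
  next
    case (AllE B t x)
    then show ?thesis using prem'[of \<Gamma> "Forall x B"] \<Gamma> val[OF \<alpha>] by (simp add: q verifies_subst)
  next
    case (ExI B t x)
    then show ?thesis using prem'[of \<Gamma> "subst x t B"] \<Gamma> val[OF \<alpha>]
      by (auto simp: q verifies_subst)
  next
    case (ExE B x)
    then obtain d where d: "d \<in> univ M" "verifies M (\<alpha>(x := d)) B"
      using prem'[of \<Gamma> "Exists x B"] \<Gamma> by (auto simp: q)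
    moreover have "\<forall>C\<in>\<Gamma>. verifies M (\<alpha>(x := d)) C"
      using ExE \<Gamma> by (auto simp: free_set_def verifies_fun_upd_fresh)
    ultimately have "verifies M (\<alpha>(x := d)) A"
      using prem[of "insert B \<Gamma>" A] upd ExE by auto
    then show ?thesis using ExE by (simp add: free_set_def verifies_fun_upd_fresh)
  next
    case (EqI t) then show ?thesis by (simp add: eq)
  next
    case (EqE B s t x)
    then show ?thesis using prem'[of \<Gamma> "Eq s t"] prem'[of \<Gamma> "subst x s B"] \<Gamma>
      by (simp add: eq verifies_subst)
  qed (use same in \<open>auto simp: q LP_iffs\<close>)
qed

lemma provable_sound:
  "provable \<Sigma> (\<Gamma> \<turnstile> A) \<Longrightarrow> entails TYPE('u) \<Sigma> \<Gamma> A"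
proof (induction "\<Gamma> \<turnstile> A" arbitrary: \<Gamma> A rule: provable_induct)
  case (rule Ps)
  then show ?case by (rule rule_inst_sound)
qed

subsection \<open>Derivability from a set of formulas\<close>

lemma is_proof_append:
  assumes "is_proof \<Sigma> \<pi>" "is_proof \<Sigma> \<rho>"
  shows "is_proof \<Sigma> (\<pi> @ \<rho>)"
  unfolding is_proof_def
proof (intro allI impI)
  fix i assume i: "i < length (\<pi> @ \<rho>)"
  show "is_sequent \<Sigma> ((\<pi> @ \<rho>) ! i) \<and>
    (\<exists>Ps. rule_inst \<Sigma> Ps ((\<pi> @ \<rho>) ! i) \<and> set Ps \<subseteq> set (take i (\<pi> @ \<rho>)))"
  proof (cases "i < length \<pi>")
    case True
    then show ?thesis using assms(1) by (simp add: is_proof_def nth_append)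
  next
    case False
    then have "i - length \<pi> < length \<rho>" using i by auto
    then show ?thesis using assms(2) False by (fastforce simp: is_proof_def nth_append)
  qed
qed

text \<open>Proofs of the premises are concatenated and the conclusion is appended.\<close>

lemma provable_rule:
  assumes "rule_inst \<Sigma> Ps S" "is_sequent \<Sigma> S" "\<forall>P\<in>set Ps. provable \<Sigma> P"
  shows "provable \<Sigma> S"
proof -
  have "\<exists>\<pi>. is_proof \<Sigma> \<pi> \<and> set Ps \<subseteq> set \<pi>"
    using assms(3)
  proof (induction Ps)
    case Nil
    show ?case by (intro exI[of _ "[]"]) (simp add: is_proof_def)
  next
    case (Cons P Ps)
    then obtain \<pi> \<rho> where "is_proof \<Sigma> \<pi>" "set Ps \<subseteq> set \<pi>" "is_proof \<Sigma> \<rho>" "\<rho> \<noteq> []" "last \<rho> = P"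
      by (auto simp: provable_def)
    then show ?case
      by (intro exI[of _ "\<pi> @ \<rho>"]) (auto simp: is_proof_append)
  qed
  then obtain \<pi> where \<pi>: "is_proof \<Sigma> \<pi>" "set Ps \<subseteq> set \<pi>" by blast
  have "is_proof \<Sigma> (\<pi> @ [S])"
    using \<pi> assms(1,2) by (auto simp: is_proof_def nth_append less_Suc_eq)
  then show ?thesis unfolding provable_def by (intro exI[of _ "\<pi> @ [S]"]) simp
qed

text \<open>Quantifying over all larger contexts makes weakening hold by definition; the price is
  that the eigenvariable rules \<open>derives_AllI\<close> and \<open>derives_ExE\<close> ask for all instances.\<close>

definition derives :: "signat \<Rightarrow> fm set \<Rightarrow> fm \<Rightarrow> bool" where
  "derives \<Sigma> \<Gamma> A \<longleftrightarrow>
     (\<forall>\<Delta>. \<Gamma> \<subseteq> \<Delta> \<and> finite \<Delta> \<and> \<Delta> \<subseteq> LP \<Sigma> \<longrightarrow> provable \<Sigma> (\<Delta> \<turnstile> A))"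

lemma derives_mono: "\<lbrakk> derives \<Sigma> \<Gamma> A; \<Gamma> \<subseteq> \<Delta> \<rbrakk> \<Longrightarrow> derives \<Sigma> \<Delta> A"
  by (auto simp: derives_def)

text \<open>A rule that leaves the context alone can be applied inside each larger finite context
  separately.\<close>

lemma derives_rule:
  assumes "\<And>\<Delta>. rule_inst \<Sigma> (map (\<lambda>B. \<Delta> \<turnstile> B) As) (\<Delta> \<turnstile> A)" "A \<in> LP \<Sigma>"
    and "\<forall>B\<in>set As. derives \<Sigma> \<Gamma> B"
  shows "derives \<Sigma> \<Gamma> A"
  unfolding derives_def
proof (intro allI impI)
  fix \<Delta> assume \<Delta>: "\<Gamma> \<subseteq> \<Delta> \<and> finite \<Delta> \<and> \<Delta> \<subseteq> LP \<Sigma>"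
  show "provable \<Sigma> (\<Delta> \<turnstile> A)"
    by (rule provable_rule[OF assms(1)]) (use assms(2,3) \<Delta> in \<open>auto simp: derives_def\<close>)
qed

lemma derives_Id: "A \<in> \<Gamma> \<Longrightarrow> derives \<Sigma> \<Gamma> A"
  unfolding derives_def
proof (intro allI impI)
  fix \<Delta> assume *: "A \<in> \<Gamma>" "\<Gamma> \<subseteq> \<Delta> \<and> finite \<Delta> \<and> \<Delta> \<subseteq> LP \<Sigma>"
  then have "provable \<Sigma> (insert A \<Delta> \<turnstile> A)"
    by (intro provable_rule[OF rule_inst.Id]) auto
  moreover have "insert A \<Delta> = \<Delta>" using * by blast
  ultimately show "provable \<Sigma> (\<Delta> \<turnstile> A)" by simp
qed

lemma derives_EM: "A \<in> LP \<Sigma> \<Longrightarrow> derives \<Sigma> \<Gamma> (Or A (Neg A))"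
  by (rule derives_rule[where As = "[]"]) (auto simp: LP_iffs intro: rule_inst.EM)

lemma derives_FE: "\<lbrakk> derives \<Sigma> \<Gamma> Falsity; A \<in> LP \<Sigma> \<rbrakk> \<Longrightarrow> derives \<Sigma> \<Gamma> A"
  by (rule derives_rule[where As = "[Falsity]"]) (auto intro: rule_inst.FE)

lemma derives_ImpE:
  "\<lbrakk> derives \<Sigma> \<Gamma> (Imp A B); derives \<Sigma> \<Gamma> A; B \<in> LP \<Sigma> \<rbrakk> \<Longrightarrow> derives \<Sigma> \<Gamma> B"
  by (rule derives_rule[where As = "[Imp A B, A]"]) (auto intro: rule_inst.ImpE)

lemma derives_ImpI:
  assumes "derives \<Sigma> (insert A \<Gamma>) B" "A \<in> LP \<Sigma>" "B \<in> LP \<Sigma>"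
  shows "derives \<Sigma> \<Gamma> (Imp A B)"
  unfolding derives_def
proof (intro allI impI)
  fix \<Delta> assume "\<Gamma> \<subseteq> \<Delta> \<and> finite \<Delta> \<and> \<Delta> \<subseteq> LP \<Sigma>"
  then show "provable \<Sigma> (\<Delta> \<turnstile> Imp A B)"
    using assms by (intro provable_rule[OF rule_inst.ImpI]) (auto simp: derives_def LP_iffs)
qed

lemma derives_OrE:
  assumes "derives \<Sigma> \<Gamma> (Or A B)" "derives \<Sigma> (insert A \<Gamma>) C" "derives \<Sigma> (insert B \<Gamma>) C"
    and "A \<in> LP \<Sigma>" "B \<in> LP \<Sigma>" "C \<in> LP \<Sigma>"
  shows "derives \<Sigma> \<Gamma> C"
  unfolding derives_def
proof (intro allI impI)
  fix \<Delta> assume \<Delta>: "\<Gamma> \<subseteq> \<Delta> \<and> finite \<Delta> \<and> \<Delta> \<subseteq> LP \<Sigma>"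
  have "provable \<Sigma> (insert D \<Delta> \<turnstile> C)" if "derives \<Sigma> (insert D \<Gamma>) C" "D \<in> LP \<Sigma>" for D
    using that \<Delta> unfolding derives_def by (metis finite_insert insert_mono insert_subset)
  moreover have "provable \<Sigma> (\<Delta> \<turnstile> Or A B)" using assms(1) \<Delta> by (simp add: derives_def)
  ultimately show "provable \<Sigma> (\<Delta> \<turnstile> C)"
    using assms \<Delta> by (intro provable_rule[OF rule_inst.OrE[of \<Sigma> \<Delta> A B C]]) auto
qed

text \<open>Every context in question is finite, so it leaves some \<open>y\<close> fresh.
  \<open>AllI\<close> applies to the instance at \<open>y\<close>, and \<open>Forall_rename\<close>
  restores the bound variable.\<close>

lemma derives_AllI:
  assumes "\<And>y. derives \<Sigma> \<Gamma> (subst x (Var y) A)" "A \<in> LP \<Sigma>"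
  shows "derives \<Sigma> \<Gamma> (Forall x A)"
  unfolding derives_def
proof (intro allI impI)
  fix \<Delta> assume \<Delta>: "\<Gamma> \<subseteq> \<Delta> \<and> finite \<Delta> \<and> \<Delta> \<subseteq> LP \<Sigma>"
  then obtain y where y: "y \<notin> free_set \<Delta> \<union> free A"
    using ex_fresh_var[of "free_set \<Delta> \<union> free A"] by (auto simp: finite_free finite_free_set)
  have "provable \<Sigma> (\<Delta> \<turnstile> Forall y (subst x (Var y) A))"
    by (rule provable_rule[OF rule_inst.AllI])
      (use assms \<Delta> y in \<open>auto simp: derives_def intro!: LP.intros subst_LP_Var\<close>)
  then show "provable \<Sigma> (\<Delta> \<turnstile> Forall x A)" using y by (simp add: Forall_rename)
qed

lemma derives_ExE:
  assumes "derives \<Sigma> \<Gamma> (Exists x A)" "\<And>y. derives \<Sigma> (insert (subst x (Var y) A) \<Gamma>) B"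
    and "A \<in> LP \<Sigma>" "B \<in> LP \<Sigma>"
  shows "derives \<Sigma> \<Gamma> B"
  unfolding derives_def
proof (intro allI impI)
  fix \<Delta> assume \<Delta>: "\<Gamma> \<subseteq> \<Delta> \<and> finite \<Delta> \<and> \<Delta> \<subseteq> LP \<Sigma>"
  then obtain y where y: "y \<notin> free_set (\<Delta> \<union> {B}) \<union> free A"
    using ex_fresh_var[of "free_set (\<Delta> \<union> {B}) \<union> free A"] by (auto simp: finite_free finite_free_set)
  have LP: "subst x (Var y) A \<in> LP \<Sigma>" using assms(3) by (rule subst_LP_Var)
  have "provable \<Sigma> (\<Delta> \<turnstile> Exists y (subst x (Var y) A))"
    using assms(1) \<Delta> y by (simp add: Exists_rename derives_def)
  moreover have "provable \<Sigma> (insert (subst x (Var y) A) \<Delta> \<turnstile> B)"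
    using assms(2)[of y] \<Delta> LP unfolding derives_def by (metis finite_insert insert_mono insert_subset)
  ultimately show "provable \<Sigma> (\<Delta> \<turnstile> B)"
    using y LP \<Delta> assms(4) by (intro provable_rule[OF rule_inst.ExE[of "subst x (Var y) A" \<Sigma> y]]) auto
qed

lemma derives_ExI:
  "\<lbrakk> derives \<Sigma> \<Gamma> (subst x t A); A \<in> LP \<Sigma>; t \<in> Terms \<Sigma> \<rbrakk> \<Longrightarrow> derives \<Sigma> \<Gamma> (Exists x A)"
  by (rule derives_rule[where As = "[subst x t A]"]) (auto intro: rule_inst.ExI LP.intros(9))

text \<open>\<open>Imp A Falsity\<close> is a classical negation: if \<open>Imp A Falsity\<close> is not true then its
  paraconsistent negation is, and the latter yields \<open>A\<close>.\<close>

lemma derives_ccontr: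
  assumes "derives \<Sigma> (insert (Imp A Falsity) \<Gamma>) Falsity" "A \<in> LP \<Sigma>"
  shows "derives \<Sigma> \<Gamma> A"
proof (rule derives_OrE)
  let ?C = "Imp A Falsity" and ?D = "And A (Neg Falsity)"
  show "derives \<Sigma> \<Gamma> (Or ?C (Neg ?C))" using assms(2) by (simp add: derives_EM LP_iffs)
  show "derives \<Sigma> (insert ?C \<Gamma>) A" using assms by (rule derives_FE)
  have "derives \<Sigma> (insert (Neg ?C) \<Gamma>) ?D"
    by (rule derives_rule[where As = "[Neg ?C]"])
      (auto simp: LP_iffs assms derives_Id intro: rule_inst.NegImp1)
  then show "derives \<Sigma> (insert (Neg ?C) \<Gamma>) A"
    by (intro derives_rule[where As = "[?D]"]) (auto simp: assms intro: rule_inst.AndE1)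
qed (simp_all add: assms LP_iffs)

text \<open>Two nested classical contradictions: if no counterexample exists, each instance of
  \<open>A\<close> follows, hence the universal formula. This will supply counterexamples for
  universal formulas outside a Henkin set.\<close>

lemma derives_not_Forall:
  assumes "A \<in> LP \<Sigma>"
  shows "derives \<Sigma> {Imp (Forall x A) Falsity} (Exists x (Imp A Falsity))"
proof (rule derives_ccontr)
  let ?E = "Exists x (Imp A Falsity)"
  let ?\<Gamma> = "{Imp ?E Falsity, Imp (Forall x A) Falsity}"
  have "derives \<Sigma> ?\<Gamma> (subst x (Var y) A)" for y
  proof (rule derives_ccontr)
    let ?\<Delta> = "insert (Imp (subst x (Var y) A) Falsity) ?\<Gamma>"
    have "derives \<Sigma> ?\<Delta> ?E"
      by (rule derives_ExI[of _ _ _ "Var y"])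
        (auto simp: assms LP_iffs Terms.intros intro: derives_Id)
    then show "derives \<Sigma> ?\<Delta> Falsity"
      by (rule derives_ImpE[rotated]) (auto simp: LP_iffs intro: derives_Id)
  qed (simp add: assms subst_LP_Var)
  then have "derives \<Sigma> ?\<Gamma> (Forall x A)" using assms by (rule derives_AllI)
  then show "derives \<Sigma> ?\<Gamma> Falsity"
    by (rule derives_ImpE[rotated]) (auto simp: LP_iffs intro: derives_Id)
qed (simp add: assms LP_iffs LP.intros)

subsection \<open>Henkin sets\<close>

text \<open>Countability of formulas drives the enumeration of the pairs below; that of terms embeds
  the term model into any infinite type.\<close>

instance fsym :: countable by countable_datatype
instance psym :: countable by countable_datatype
instance tm :: countable by countable_datatype
instance fm :: countable by countable_datatype

text \<open>Finiteness in \<open>derives_closed\<close> matters, since \<open>derives\<close> holds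
  vacuously for an infinite context. Completeness is stated with the classical negation because
  \<open>A\<close> and \<open>Neg A\<close> may both belong to \<Delta> or be refuted only by way of
  \<open>Imp A Falsity\<close>.\<close>

locale henkin_set =
  fixes \<Sigma> :: signat and \<Delta> :: "fm set"
  assumes subset_LP: "\<Delta> \<subseteq> LP \<Sigma>"
    and derives_closed: "\<lbrakk> finite \<Gamma>; \<Gamma> \<subseteq> \<Delta>; derives \<Sigma> \<Gamma> A; A \<in> LP \<Sigma> \<rbrakk> \<Longrightarrow> A \<in> \<Delta>"
    and Falsity_notin: "Falsity \<notin> \<Delta>"
    and complete: "\<lbrakk> A \<in> LP \<Sigma>; A \<notin> \<Delta> \<rbrakk> \<Longrightarrow> Imp A Falsity \<in> \<Delta>"
    and witness: "\<lbrakk> A \<in> LP \<Sigma>; Exists x A \<in> \<Delta> \<rbrakk> \<Longrightarrow> \<exists>y. subst x (Var y) A \<in> \<Delta>"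

text \<open>Step \<open>(B, x)\<close> adds an instance of \<open>B\<close> at \<open>x\<close> if this is consistently possible. With
  \<open>x\<close> not free in \<open>B\<close> this decides \<open>B\<close> itself, so the same step provides completeness and witnesses.\<close>

definition henkin_step :: "signat \<Rightarrow> fm set \<Rightarrow> fm \<times> var \<Rightarrow> fm set" where
  "henkin_step \<Sigma> \<Gamma> = (\<lambda>(B, x).
     if B \<in> LP \<Sigma> \<and> (\<exists>y. \<not> derives \<Sigma> (insert (subst x (Var y) B) \<Gamma>) Falsity)
     then insert (subst x (Var (SOME y. \<not> derives \<Sigma> (insert (subst x (Var y) B) \<Gamma>) Falsity)) B) \<Gamma>
     else \<Gamma>)"

primrec henkin_chain :: "signat \<Rightarrow> fm set \<Rightarrow> nat \<Rightarrow> fm set" where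
  "henkin_chain \<Sigma> \<Gamma> 0 = \<Gamma>"
| "henkin_chain \<Sigma> \<Gamma> (Suc n) = henkin_step \<Sigma> (henkin_chain \<Sigma> \<Gamma> n) (from_nat n)"

lemma henkin_step_extends: "\<Gamma> \<subseteq> henkin_step \<Sigma> \<Gamma> p"
  by (auto simp: henkin_step_def split: prod.splits)

lemma henkin_step_consistent:
  assumes "finite \<Gamma>" "\<Gamma> \<subseteq> LP \<Sigma>" "\<not> derives \<Sigma> \<Gamma> Falsity"
  shows "finite (henkin_step \<Sigma> \<Gamma> p) \<and> henkin_step \<Sigma> \<Gamma> p \<subseteq> LP \<Sigma> \<and>
    \<not> derives \<Sigma> (henkin_step \<Sigma> \<Gamma> p) Falsity"
proof (cases p)
  case (Pair B x)
  have "\<not> derives \<Sigma> (insert (subst x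
      (Var (SOME y. \<not> derives \<Sigma> (insert (subst x (Var y) B) \<Gamma>) Falsity)) B) \<Gamma>) Falsity"
    if "\<exists>y. \<not> derives \<Sigma> (insert (subst x (Var y) B) \<Gamma>) Falsity"
    using that by (rule someI_ex)
  then show ?thesis using assms Pair by (simp add: henkin_step_def subst_LP_Var)
qed

text \<open>If every instance is inconsistent with \<Gamma>, existential elimination refutes
  \<open>Exists x B\<close>. The refutation persists when \<Gamma> grows, so one visit to each pair
  suffices.\<close>

lemma henkin_step_decides:
  assumes "B \<in> LP \<Sigma>"
  shows "(\<exists>y. subst x (Var y) B \<in> henkin_step \<Sigma> \<Gamma> (B, x)) \<or>
    derives \<Sigma> \<Gamma> (Imp (Exists x B) Falsity)"
proof (cases "\<exists>y. \<not> derives \<Sigma> (insert (subst x (Var y) B) \<Gamma>) Falsity")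
  case True
  then show ?thesis using assms by (auto simp: henkin_step_def)
next
  case False
  have "derives \<Sigma> (insert (Exists x B) \<Gamma>) Falsity"
  proof (rule derives_ExE)
    show "derives \<Sigma> (insert (Exists x B) \<Gamma>) (Exists x B)" by (simp add: derives_Id)
    show "derives \<Sigma> (insert (subst x (Var y) B) (insert (Exists x B) \<Gamma>)) Falsity" for y
      using False by (blast intro: derives_mono)
  qed (use assms in \<open>auto intro: LP.intros\<close>)
  then show ?thesis using assms by (blast intro: derives_ImpI LP.intros)
qed

lemma henkin_chain_mono: "m \<le> n \<Longrightarrow> henkin_chain \<Sigma> \<Gamma> m \<subseteq> henkin_chain \<Sigma> \<Gamma> n"
  by (rule lift_Suc_mono_le[of "henkin_chain \<Sigma> \<Gamma>"]) (simp_all add: henkin_step_extends)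

lemma finite_subset_henkin_chain:
  "\<lbrakk> finite G; G \<subseteq> (\<Union>n. henkin_chain \<Sigma> \<Gamma> n) \<rbrakk> \<Longrightarrow> \<exists>n. G \<subseteq> henkin_chain \<Sigma> \<Gamma> n"
proof (induction G rule: finite_induct)
  case (insert A G)
  then obtain m n where "G \<subseteq> henkin_chain \<Sigma> \<Gamma> m" "A \<in> henkin_chain \<Sigma> \<Gamma> n" by auto
  then have "insert A G \<subseteq> henkin_chain \<Sigma> \<Gamma> (max m n)"
    using henkin_chain_mono[of m "max m n"] henkin_chain_mono[of n "max m n"] by fastforce
  then show ?case ..
qed simp

lemma henkin_set_henkin_chain:
  assumes "finite \<Gamma>" "\<Gamma> \<subseteq> LP \<Sigma>" "\<not> derives \<Sigma> \<Gamma> Falsity"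
  shows "henkin_set \<Sigma> (\<Union>n. henkin_chain \<Sigma> \<Gamma> n)"
proof -
  let ?C = "henkin_chain \<Sigma> \<Gamma>" and ?\<Delta> = "\<Union>n. henkin_chain \<Sigma> \<Gamma> n"
  have inv: "finite (?C n) \<and> ?C n \<subseteq> LP \<Sigma> \<and> \<not> derives \<Sigma> (?C n) Falsity" for n
  proof (induction n)
    case (Suc n)
    then show ?case using henkin_step_consistent[of "?C n"] by simp
  qed (use assms in simp)
  have decide: "(\<exists>y. subst x (Var y) B \<in> ?\<Delta>) \<or> (\<exists>n. derives \<Sigma> (?C n) (Imp (Exists x B) Falsity))"
    if "B \<in> LP \<Sigma>" for x B
  proof -
    \<comment> \<open>The pair is treated at the stage given by its own code.\<close>
    have "?C (Suc (to_nat (B, x))) = henkin_step \<Sigma> (?C (to_nat (B, x))) (B, x)" by simp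
    then show ?thesis using henkin_step_decides[OF that, of x "?C (to_nat (B, x))"] by blast
  qed
  \<comment> \<open>Both derivations are moved to the later of the two stages, which is
    consistent.\<close>
  have clash: False
    if "derives \<Sigma> (?C m) (Imp A Falsity)" "derives \<Sigma> (?C n) A" for A m n
  proof -
    have "derives \<Sigma> (?C (max m n)) (Imp A Falsity)" "derives \<Sigma> (?C (max m n)) A"
      using that derives_mono[OF _ henkin_chain_mono[of _ "max m n"]] by auto
    then have "derives \<Sigma> (?C (max m n)) Falsity"
      by (rule derives_ImpE) (rule LP.intros)
    then show False using inv by blast
  qed
  have neg: "\<exists>n. derives \<Sigma> (?C n) (Imp A Falsity)" if A: "A \<in> LP \<Sigma>" "A \<notin> ?\<Delta>" for A
  proof -
    \<comment> \<open>With \<open>x\<close> fresh every instance of \<open>A\<close> is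
      \<open>A\<close> itself, so deciding \<open>Exists x A\<close> decides
      \<open>A\<close>.\<close>
    obtain x where x: "x \<notin> free A" using ex_fresh_var[OF finite_free] by blast
    then obtain n where n: "derives \<Sigma> (?C n) (Imp (Exists x A) Falsity)"
      using decide[of A x] A by (auto simp: subst_fresh)
    have "derives \<Sigma> (insert A (?C n)) (Exists x A)"
      by (rule derives_ExI[of _ _ _ "Var x"]) (auto simp: subst_fresh x A intro: derives_Id Terms.intros)
    with derives_mono[OF n subset_insertI] have "derives \<Sigma> (insert A (?C n)) Falsity"
      by (rule derives_ImpE) (rule LP.intros)
    then show ?thesis using derives_ImpI[OF _ A(1) LP.intros(1)] by blast
  qed
  have closed: "A \<in> ?\<Delta>" if G: "finite G" "G \<subseteq> ?\<Delta>" "derives \<Sigma> G A" "A \<in> LP \<Sigma>" for G A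
  proof (rule ccontr)
    assume "A \<notin> ?\<Delta>"
    \<comment> \<open>A finite subset of the union already lies in a single stage.\<close>
    moreover obtain n where "derives \<Sigma> (?C n) A"
      using finite_subset_henkin_chain[OF G(1,2)] derives_mono[OF G(3)] by blast
    ultimately show False using neg[OF G(4)] clash by blast
  qed
  show ?thesis
  proof
    show "?\<Delta> \<subseteq> LP \<Sigma>" using inv by blast
    show "Falsity \<notin> ?\<Delta>" using inv derives_Id by blast
    show "Imp A Falsity \<in> ?\<Delta>" if A: "A \<in> LP \<Sigma>" "A \<notin> ?\<Delta>" for A
    proof -
      obtain n where "derives \<Sigma> (?C n) (Imp A Falsity)" using neg[OF A] by blast
      then show ?thesis using inv A(1) by (intro closed[of "?C n"]) (auto simp: LP_iffs)
    qed
    show "\<exists>y. subst x (Var y) A \<in> ?\<Delta>" if A: "A \<in> LP \<Sigma>" "Exists x A \<in> ?\<Delta>" for x A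
    proof -
      from A(2) obtain n where "derives \<Sigma> (?C n) (Exists x A)" by (auto intro: derives_Id)
      then show ?thesis using decide[OF A(1), of x] clash by blast
    qed
  qed (fact closed)
qed

section \<open>Closure of Henkin sets under the rules, connective by connective\<close>

context henkin_set
begin

text \<open>Turns each rule with unchanged context into a closure property of \<Delta>, with the
  finite premise list as the context.\<close>

lemma rule_closed:
  assumes "\<And>\<Gamma>. rule_inst \<Sigma> (map (\<lambda>B. \<Gamma> \<turnstile> B) As) (\<Gamma> \<turnstile> A)" "A \<in> LP \<Sigma>" "set As \<subseteq> \<Delta>"
  shows "A \<in> \<Delta>"
proof (rule derives_closed)
  show "derives \<Sigma> (set As) A" by (rule derives_rule[OF assms(1,2)]) (simp add: derives_Id)
qed (use assms in auto)

lemma rule_closed0: "\<lbrakk> \<And>\<Gamma>. rule_inst \<Sigma> [] (\<Gamma> \<turnstile> A); A \<in> LP \<Sigma> \<rbrakk> \<Longrightarrow> A \<in> \<Delta>"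
  using rule_closed[of "[]"] by simp

lemma rule_closed1:
  "\<lbrakk> B \<in> \<Delta>; \<And>\<Gamma>. rule_inst \<Sigma> [\<Gamma> \<turnstile> B] (\<Gamma> \<turnstile> A); A \<in> LP \<Sigma> \<rbrakk> \<Longrightarrow> A \<in> \<Delta>"
  using rule_closed[of "[B]"] by simp

lemma rule_closed2:
  "\<lbrakk> B \<in> \<Delta>; C \<in> \<Delta>; \<And>\<Gamma>. rule_inst \<Sigma> [\<Gamma> \<turnstile> B, \<Gamma> \<turnstile> C] (\<Gamma> \<turnstile> A); A \<in> LP \<Sigma> \<rbrakk> \<Longrightarrow> A \<in> \<Delta>"
  using rule_closed[of "[B, C]"] by simp

lemma rule_closed_iff:
  "\<lbrakk> \<And>\<Gamma>. rule_inst \<Sigma> [\<Gamma> \<turnstile> A] (\<Gamma> \<turnstile> B); \<And>\<Gamma>. rule_inst \<Sigma> [\<Gamma> \<turnstile> B] (\<Gamma> \<turnstile> A); A \<in> LP \<Sigma>; B \<in> LP \<Sigma> \<rbrakk>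
    \<Longrightarrow> A \<in> \<Delta> \<longleftrightarrow> B \<in> \<Delta>"
  using rule_closed1 by blast

lemma Imp_mem_elim: "\<lbrakk> Imp A B \<in> \<Delta>; A \<in> \<Delta> \<rbrakk> \<Longrightarrow> B \<in> \<Delta>"
  using rule_closed2[OF _ _ rule_inst.ImpE, of A B] subset_LP by (auto simp: LP_iffs)

lemma And_mem_iff: "And A B \<in> \<Delta> \<longleftrightarrow> A \<in> \<Delta> \<and> B \<in> \<Delta>"
proof
  assume *: "And A B \<in> \<Delta>"
  then have "A \<in> LP \<Sigma>" "B \<in> LP \<Sigma>" using subset_LP by (auto simp: LP_iffs)
  then show "A \<in> \<Delta> \<and> B \<in> \<Delta>"
    using rule_closed1[OF * rule_inst.AndE1] rule_closed1[OF * rule_inst.AndE2] by blast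
next
  assume "A \<in> \<Delta> \<and> B \<in> \<Delta>"
  then show "And A B \<in> \<Delta>"
    using rule_closed2[OF _ _ rule_inst.AndI] subset_LP by (auto simp: LP_iffs)
qed

text \<open>If neither disjunct were in \<Delta>, both classical negations would be, and
  \<open>OrE\<close> would derive \<open>Falsity\<close>.\<close>

lemma Or_mem_iff:
  assumes "A \<in> LP \<Sigma>" "B \<in> LP \<Sigma>"
  shows "Or A B \<in> \<Delta> \<longleftrightarrow> A \<in> \<Delta> \<or> B \<in> \<Delta>"
proof
  assume *: "Or A B \<in> \<Delta>"
  show "A \<in> \<Delta> \<or> B \<in> \<Delta>"
  proof (rule ccontr)
    assume "\<not> (A \<in> \<Delta> \<or> B \<in> \<Delta>)"
    then have mem: "{Or A B, Imp A Falsity, Imp B Falsity} \<subseteq> \<Delta>"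
      using * assms complete by blast
    have "derives \<Sigma> {Or A B, Imp A Falsity, Imp B Falsity} Falsity"
      by (rule derives_OrE[of _ _ A B])
        (auto intro: derives_ImpE[of _ _ A] derives_ImpE[of _ _ B] derives_Id simp: assms LP_iffs)
    then show False using derives_closed[OF _ mem] Falsity_notin by (simp add: LP_iffs)
  qed
next
  assume "A \<in> \<Delta> \<or> B \<in> \<Delta>"
  then show "Or A B \<in> \<Delta>"
    using rule_closed1[OF _ rule_inst.OrI1] rule_closed1[OF _ rule_inst.OrI2] assms
    by (auto simp: LP_iffs)
qed

text \<open>Excludes the case that neither formula belongs to \<Delta>, so that three truth values
  suffice for atoms.\<close>

lemma mem_or_Neg_mem: "A \<in> LP \<Sigma> \<Longrightarrow> A \<in> \<Delta> \<or> Neg A \<in> \<Delta>"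
  using rule_closed0[OF rule_inst.EM, of A] by (simp add: Or_mem_iff LP_iffs)

text \<open>When \<open>A\<close> is outside \<Delta>, its classical negation is inside and yields
  the implication through \<open>Falsity\<close>.\<close>

lemma Imp_mem_iff:
  assumes "A \<in> LP \<Sigma>" "B \<in> LP \<Sigma>"
  shows "Imp A B \<in> \<Delta> \<longleftrightarrow> (A \<in> \<Delta> \<longrightarrow> B \<in> \<Delta>)"
proof
  assume *: "A \<in> \<Delta> \<longrightarrow> B \<in> \<Delta>"
  show "Imp A B \<in> \<Delta>"
  proof (cases "B \<in> \<Delta>")
    case True
    have "derives \<Sigma> {B} (Imp A B)"
      by (rule derives_ImpI) (auto simp: assms derives_Id)
    then show ?thesis using derives_closed[of "{B}"] True assms by (simp add: LP_iffs)
  next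
    case False
    then have "Imp A Falsity \<in> \<Delta>" using * assms complete by blast
    moreover have "derives \<Sigma> {Imp A Falsity} (Imp A B)"
    proof (rule derives_ImpI)
      have "derives \<Sigma> {A, Imp A Falsity} Falsity"
        by (rule derives_ImpE[of _ _ A]) (auto simp: derives_Id LP_iffs)
      then show "derives \<Sigma> {A, Imp A Falsity} B" using assms by (blast intro: derives_FE)
    qed (use assms in auto)
    ultimately show ?thesis using derives_closed[of "{Imp A Falsity}"] assms by (simp add: LP_iffs)
  qed
qed (blast intro: Imp_mem_elim)

lemma Exists_mem_iff:
  assumes "A \<in> LP \<Sigma>"
  shows "Exists x A \<in> \<Delta> \<longleftrightarrow> (\<exists>t\<in>Terms \<Sigma>. subst x t A \<in> \<Delta>)"
  using witness[OF assms] rule_closed1[OF _ rule_inst.ExI] assms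
  by (meson LP.intros(9) Terms.intros(1))

lemma Forall_mem_iff:
  assumes "A \<in> LP \<Sigma>"
  shows "Forall x A \<in> \<Delta> \<longleftrightarrow> (\<forall>t\<in>Terms \<Sigma>. subst x t A \<in> \<Delta>)"
proof
  assume "Forall x A \<in> \<Delta>"
  then show "\<forall>t\<in>Terms \<Sigma>. subst x t A \<in> \<Delta>"
    using rule_closed1[OF _ rule_inst.AllE] assms subst_LP by blast
next
  assume *: "\<forall>t\<in>Terms \<Sigma>. subst x t A \<in> \<Delta>"
  show "Forall x A \<in> \<Delta>"
  proof (rule ccontr)
    assume "Forall x A \<notin> \<Delta>"
    then have "Imp (Forall x A) Falsity \<in> \<Delta>" using complete LP.intros(8)[OF assms] by blast
    then have "Exists x (Imp A Falsity) \<in> \<Delta>"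
      using derives_closed[OF _ _ derives_not_Forall] assms by (simp add: LP.intros(1,7,9))
    then obtain t where "t \<in> Terms \<Sigma>" "Imp (subst x t A) Falsity \<in> \<Delta>"
      using assms by (auto simp: Exists_mem_iff LP_iffs)
    then show False using * Imp_mem_elim Falsity_notin by blast
  qed
qed

text \<open>These reduce negated compounds to formulas covered by the membership lemmas above, as
  the clauses for \<open>falsifies\<close> require.\<close>

lemma Neg_mem_iffs:
  shows "A \<in> LP \<Sigma> \<Longrightarrow> Neg (Neg A) \<in> \<Delta> \<longleftrightarrow> A \<in> \<Delta>"
    and "\<lbrakk> A \<in> LP \<Sigma>; B \<in> LP \<Sigma> \<rbrakk> \<Longrightarrow> Neg (And A B) \<in> \<Delta> \<longleftrightarrow> Or (Neg A) (Neg B) \<in> \<Delta>"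
    and "\<lbrakk> A \<in> LP \<Sigma>; B \<in> LP \<Sigma> \<rbrakk> \<Longrightarrow> Neg (Or A B) \<in> \<Delta> \<longleftrightarrow> And (Neg A) (Neg B) \<in> \<Delta>"
    and "\<lbrakk> A \<in> LP \<Sigma>; B \<in> LP \<Sigma> \<rbrakk> \<Longrightarrow> Neg (Imp A B) \<in> \<Delta> \<longleftrightarrow> And A (Neg B) \<in> \<Delta>"
    and "A \<in> LP \<Sigma> \<Longrightarrow> Neg (Forall x A) \<in> \<Delta> \<longleftrightarrow> Exists x (Neg A) \<in> \<Delta>"
    and "A \<in> LP \<Sigma> \<Longrightarrow> Neg (Exists x A) \<in> \<Delta> \<longleftrightarrow> Forall x (Neg A) \<in> \<Delta>"
  by (rule rule_closed_iff[OF rule_inst.NegNeg1 rule_inst.NegNeg2]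
      rule_closed_iff[OF rule_inst.NegAnd1 rule_inst.NegAnd2]
      rule_closed_iff[OF rule_inst.NegOr1 rule_inst.NegOr2]
      rule_closed_iff[OF rule_inst.NegImp1 rule_inst.NegImp2]
      rule_closed_iff[OF rule_inst.NegAll1 rule_inst.NegAll2]
      rule_closed_iff[OF rule_inst.NegEx1 rule_inst.NegEx2]; simp add: LP_iffs LP.intros)+

lemma Neg_Falsity_mem: "Neg Falsity \<in> \<Delta>"
  by (rule rule_closed0[OF rule_inst.TI]) (simp add: LP_iffs)

subsection \<open>The term model\<close>

lemma Eq_refl_mem: "t \<in> Terms \<Sigma> \<Longrightarrow> Eq t t \<in> \<Delta>"
  by (rule rule_closed0[OF rule_inst.EqI]) (simp_all add: LP_iffs)

lemma Eq_mem_Terms: "Eq s t \<in> \<Delta> \<Longrightarrow> s \<in> Terms \<Sigma> \<and> t \<in> Terms \<Sigma>"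
  using subset_LP by (auto simp: LP_iffs)

lemma Eq_mem_subst:
  assumes "Eq s t \<in> \<Delta>" "subst x s A \<in> \<Delta>" "A \<in> LP \<Sigma>"
  shows "subst x t A \<in> \<Delta>"
  using rule_closed2[OF assms(1,2) rule_inst.EqE] Eq_mem_Terms[OF assms(1)] assms(3) subst_LP
  by blast

text \<open>Replace \<open>x\<close> in \<open>Eq (Var x) s\<close>, with \<open>x\<close> fresh for
  \<open>s\<close>: the instance at \<open>s\<close> is reflexivity.\<close>

lemma Eq_mem_sym:
  assumes "Eq s t \<in> \<Delta>"
  shows "Eq t s \<in> \<Delta>"
proof -
  obtain x where x: "x \<notin> free_tm s" using ex_fresh_var[OF finite_free_tm] by blast
  then show ?thesis
    using Eq_mem_subst[OF assms, of x "Eq (Var x) s"] Eq_mem_Terms[OF assms] Eq_refl_mem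
    by (simp add: subst_fresh_tm LP_iffs Terms.intros)
qed

lemma Eq_mem_trans:
  assumes "Eq s t \<in> \<Delta>" "Eq t u \<in> \<Delta>"
  shows "Eq s u \<in> \<Delta>"
proof -
  obtain x where x: "x \<notin> free_tm s" using ex_fresh_var[OF finite_free_tm] by blast
  then show ?thesis
    using Eq_mem_subst[OF assms(2), of x "Eq s (Var x)"] Eq_mem_Terms[OF assms(1)] assms(1)
    by (simp add: subst_fresh_tm LP_iffs Terms.intros)
qed

text \<open>An equation may be in \<Delta> together with its negation, so membership of negated
  equations needs its own congruence, one side at a time.\<close>

lemma Neg_Eq_mem_cong:
  assumes "Neg (Eq s t) \<in> \<Delta>" "Eq s s' \<in> \<Delta>" "Eq t t' \<in> \<Delta>"
  shows "Neg (Eq s' t') \<in> \<Delta>"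
proof -
  obtain x where x: "x \<notin> free_tm t \<union> free_tm s'"
    using ex_fresh_var[of "free_tm t \<union> free_tm s'"] by (auto simp: finite_free_tm)
  then have "Neg (Eq s' t) \<in> \<Delta>"
    using Eq_mem_subst[OF assms(2), of x "Neg (Eq (Var x) t)"] Eq_mem_Terms[OF assms(3)] assms(1)
    by (simp add: subst_fresh_tm LP_iffs Terms.intros)
  then show ?thesis
    using Eq_mem_subst[OF assms(3), of x "Neg (Eq s' (Var x))"] Eq_mem_Terms[OF assms(2)] x
    by (simp add: subst_fresh_tm LP_iffs Terms.intros)
qed

text \<open>Arguments are replaced one by one; \<open>pre\<close> collects those already treated.
  The condition on \<open>V\<close> says that a suitably fresh variable occurs in \<Phi> only at the
  position being replaced. One lemma thus covers predicates, their negations and function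
  terms.\<close>

lemma Eq_mem_cong:
  assumes "list_all2 (\<lambda>s t. Eq s t \<in> \<Delta>) ss ts" "\<Phi> (pre @ ss) \<in> \<Delta>"
    and "set pre \<subseteq> Terms \<Sigma>" "length (pre @ ss) = n"
    and \<Phi>: "\<And>ts. \<lbrakk> set ts \<subseteq> Terms \<Sigma>; length ts = n \<rbrakk> \<Longrightarrow> \<Phi> ts \<in> LP \<Sigma>"
    and V: "finite V" "\<And>x t pre post. x \<notin> V \<union> (\<Union>s\<in>set pre \<union> set post. free_tm s) \<Longrightarrow>
      subst x t (\<Phi> (pre @ Var x # post)) = \<Phi> (pre @ t # post)"
  shows "\<Phi> (pre @ ts) \<in> \<Delta>"
  using assms(1-4)
proof (induction ss ts arbitrary: pre rule: list_all2_induct)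
  case (Cons s ss t ts)
  have Terms: "set ss \<subseteq> Terms \<Sigma>"
    using Cons.hyps(2) Eq_mem_Terms by (fastforce simp: list_all2_conv_all_nth in_set_conv_nth)
  obtain x where "x \<notin> V \<union> (\<Union>s\<in>set pre \<union> set ss. free_tm s)"
    using ex_fresh_var[of "V \<union> (\<Union>s\<in>set pre \<union> set ss. free_tm s)"] V(1)
    by (auto simp: finite_free_tm)
  note sub = V(2)[OF this]
  have "\<Phi> (pre @ Var x # ss) \<in> LP \<Sigma>"
    using Terms Cons.prems by (intro \<Phi>) (auto intro: Terms.intros)
  then have "\<Phi> (pre @ t # ss) \<in> \<Delta>"
    using Eq_mem_subst[OF Cons.hyps(1), of x "\<Phi> (pre @ Var x # ss)"] Cons.prems(1)
    by (simp add: sub)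
  then show ?case
    using Cons.IH[of "pre @ [t]"] Cons.prems Eq_mem_Terms[OF Cons.hyps(1)] by simp
qed simp

text \<open>Representatives stand in for equality classes so that the elements of the model remain
  terms, which can be coded in the type \<open>'u\<close>.\<close>

definition rep :: "tm \<Rightarrow> tm" where
  "rep t = (SOME s. Eq t s \<in> \<Delta>)"

lemma Eq_rep_mem: "t \<in> Terms \<Sigma> \<Longrightarrow> Eq t (rep t) \<in> \<Delta>"
  unfolding rep_def by (rule someI) (rule Eq_refl_mem)

lemma rep_Terms: "t \<in> Terms \<Sigma> \<Longrightarrow> rep t \<in> Terms \<Sigma>"
  using Eq_rep_mem Eq_mem_Terms by blast

lemma rep_eq_iff:
  assumes "s \<in> Terms \<Sigma>" "t \<in> Terms \<Sigma>"
  shows "rep s = rep t \<longleftrightarrow> Eq s t \<in> \<Delta>"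
proof
  assume "rep s = rep t"
  then show "Eq s t \<in> \<Delta>" using Eq_rep_mem assms Eq_mem_sym Eq_mem_trans by metis
next
  assume "Eq s t \<in> \<Delta>"
  \<comment> \<open>The choice in \<open>rep\<close> depends only on the class, so equal classes
    give the same choice.\<close>
  then have "(\<lambda>u. Eq s u \<in> \<Delta>) = (\<lambda>u. Eq t u \<in> \<Delta>)" using Eq_mem_sym Eq_mem_trans by blast
  then show "rep s = rep t" by (simp add: rep_def)
qed

lemma rep_rep: "t \<in> Terms \<Sigma> \<Longrightarrow> rep (rep t) = rep t"
  by (simp add: rep_eq_iff rep_Terms Eq_rep_mem Eq_mem_sym)

lemma list_all2_Eq_rep:
  assumes "set ts \<subseteq> Terms \<Sigma>"
  shows "list_all2 (\<lambda>s t. Eq s t \<in> \<Delta>) ts (map rep ts)"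
    and "list_all2 (\<lambda>s t. Eq s t \<in> \<Delta>) (map rep ts) ts"
  using assms by (auto simp: list_all2_conv_all_nth subset_iff Eq_rep_mem Eq_mem_sym)

text \<open>The interpretation of \<open>f\<close> respects equality: starting from reflexivity, the
  arguments on the right are replaced while \<open>V\<close> protects the left side.\<close>

lemma rep_Fn_map_rep:
  assumes "Fn f ts \<in> Terms \<Sigma>"
  shows "rep (Fn f (map rep ts)) = rep (Fn f ts)"
proof -
  from assms have f: "FunS f \<in> \<Sigma>" "length ts = farity f" "set ts \<subseteq> Terms \<Sigma>"
    by (auto elim: Terms.cases)
  then have f': "Fn f (map rep ts) \<in> Terms \<Sigma>" by (auto intro!: Terms.intros rep_Terms)
  have "Eq (Fn f ts) (Fn f ([] @ map rep ts)) \<in> \<Delta>"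
  proof (rule Eq_mem_cong[where \<Phi> = "\<lambda>us. Eq (Fn f ts) (Fn f us)" and V = "free_tm (Fn f ts)"])
    show "Eq (Fn f ts) (Fn f us) \<in> LP \<Sigma>" if "set us \<subseteq> Terms \<Sigma>" "length us = length ts" for us
      using that f assms by (auto simp: LP_iffs intro!: Terms.intros(2))
    show "subst x t (Eq (Fn f ts) (Fn f (pre @ Var x # post))) = Eq (Fn f ts) (Fn f (pre @ t # post))"
      if "x \<notin> free_tm (Fn f ts) \<union> (\<Union>s\<in>set pre \<union> set post. free_tm s)" for x t pre post
      using that by (auto simp: subst_fresh_tm map_idI)
  qed (use f assms in \<open>auto simp: list_all2_Eq_rep Eq_refl_mem finite_free_tm\<close>)
  then show ?thesis using assms f' Eq_mem_sym by (simp add: rep_eq_iff)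
qed

lemma Pred_mem_map_rep:
  assumes "Pred p ts \<in> LP \<Sigma>"
  shows "Pred p (map rep ts) \<in> \<Delta> \<longleftrightarrow> Pred p ts \<in> \<Delta>"
    and "Neg (Pred p (map rep ts)) \<in> \<Delta> \<longleftrightarrow> Neg (Pred p ts) \<in> \<Delta>"
proof -
  from assms have p: "PredS p \<in> \<Sigma>" "length ts = parity p" and ts: "set ts \<subseteq> Terms \<Sigma>"
    by (auto elim: LP.cases simp: Forall_def Exists_def)
  have cong: "Pred p us \<in> \<Delta> \<Longrightarrow> Pred p vs \<in> \<Delta>"
    "Neg (Pred p us) \<in> \<Delta> \<Longrightarrow> Neg (Pred p vs) \<in> \<Delta>"
    if "list_all2 (\<lambda>s t. Eq s t \<in> \<Delta>) us vs" "length us = parity p" for us vs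
    using Eq_mem_cong[OF that(1), of "Pred p" "[]" "parity p" "{}"]
      Eq_mem_cong[OF that(1), of "\<lambda>ts. Neg (Pred p ts)" "[]" "parity p" "{}"] that(2) p(1)
    by (auto simp: subst_fresh_tm map_idI LP_iffs intro: LP.intros)
  show "Pred p (map rep ts) \<in> \<Delta> \<longleftrightarrow> Pred p ts \<in> \<Delta>"
    "Neg (Pred p (map rep ts)) \<in> \<Delta> \<longleftrightarrow> Neg (Pred p ts) \<in> \<Delta>"
    using cong list_all2_Eq_rep[OF ts] p(2) by (metis length_map)+
qed

section \<open>The three-valued structure on representatives and its truth lemma\<close>

definition atom_value :: "fm \<Rightarrow> tval" where
  "atom_value A = (if A \<notin> \<Delta> then FF else if Neg A \<notin> \<Delta> then TT else BB)"

text \<open>The second part rests on excluded middle: an atom outside \<Delta> has value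
  \<open>FF\<close>, and its negation is then in \<Delta>.\<close>

lemma atom_value_neq:
  "atom_value A \<noteq> FF \<longleftrightarrow> A \<in> \<Delta>"
  "A \<in> LP \<Sigma> \<Longrightarrow> atom_value A \<noteq> TT \<longleftrightarrow> Neg A \<in> \<Delta>"
  using mem_or_Neg_mem by (auto simp: atom_value_def)

text \<open>The map \<open>g\<close> codes terms as elements of \<open>'u\<close>, and
  \<open>inv g\<close> decodes them.\<close>

definition term_model :: "(tm \<Rightarrow> 'u) \<Rightarrow> 'u struct" where
  "term_model g = \<lparr>univ = (\<lambda>t. g (rep t)) ` Terms \<Sigma>,
     fint = \<lambda>f ds. g (rep (Fn f (map (inv g) ds))),
     pint = \<lambda>p ds. atom_value (Pred p (map (inv g) ds)),
     eqint = \<lambda>d d'. atom_value (Eq (inv g d) (inv g d'))\<rparr>"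

definition term_assignment :: "(tm \<Rightarrow> 'u) \<Rightarrow> var \<Rightarrow> 'u" where
  "term_assignment g x = g (rep (Var x))"

context
  fixes g :: "tm \<Rightarrow> 'u"
  assumes g: "inj g"
begin

lemma term_model_map_rep:
  "fint (term_model g) f (map (\<lambda>t. g (rep t)) ts) = g (rep (Fn f (map rep ts)))"
  "pint (term_model g) p (map (\<lambda>t. g (rep t)) ts) = atom_value (Pred p (map rep ts))"
  using g by (simp_all add: term_model_def o_def)

lemma is_struct_term_model: "is_struct \<Sigma> (term_model g)"
proof -
  have "fint (term_model g) f ds \<in> univ (term_model g)"
    if f: "FunS f \<in> \<Sigma>" "length ds = farity f" "set ds \<subseteq> univ (term_model g)" for f ds
  proof -
    have "Fn f (map (inv g) ds) \<in> Terms \<Sigma>"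
      using f g by (intro Terms.intros) (auto simp: term_model_def rep_Terms)
    then show ?thesis by (simp add: term_model_def)
  qed
  moreover have "eqint (term_model g) d d \<in> {TT, BB}" if "d \<in> univ (term_model g)" for d
    using that g Eq_refl_mem[OF rep_Terms] by (auto simp: term_model_def atom_value_def)
  \<comment> \<open>Distinct representatives are never equated in \<Delta>, as \<open>rep\<close> is
    idempotent.\<close>
  moreover have "eqint (term_model g) d d' = FF"
    if "d \<in> univ (term_model g)" "d' \<in> univ (term_model g)" "d \<noteq> d'" for d d'
    using that g by (auto simp: term_model_def atom_value_def rep_Terms rep_rep simp flip: rep_eq_iff)
  moreover have "univ (term_model g) \<noteq> {}" using Terms.intros(1) by (auto simp: term_model_def)
  ultimately show ?thesis unfolding is_struct_def by blast
qed

lemma is_assignment_term_assignment: "is_assignment (term_model g) (term_assignment g)"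
  by (auto simp: is_assignment_def term_model_def term_assignment_def intro: Terms.intros)

lemma val_tm_term_model:
  "t \<in> Terms \<Sigma> \<Longrightarrow> val_tm (term_model g) [] (term_assignment g) t = g (rep t)"
proof (induction rule: Terms.induct)
  case (2 f ts)
  then have "map (val_tm (term_model g) [] (term_assignment g)) ts = map (\<lambda>t. g (rep t)) ts" by simp
  then have "val_tm (term_model g) [] (term_assignment g) (Fn f ts) = g (rep (Fn f (map rep ts)))"
    by (simp only: val_tm.simps term_model_map_rep)
  then show ?case using 2 by (simp add: rep_Fn_map_rep Terms.intros)
qed (simp add: term_assignment_def)

text \<open>The induction is on \<open>fsize\<close> because the quantifier cases need the
  hypothesis for all instances \<open>subst x t B\<close>, which are not subformulas.\<close>

lemma term_model_truth:
  "A \<in> LP \<Sigma> \<Longrightarrow> (verifies (term_model g) (term_assignment g) A \<longleftrightarrow> A \<in> \<Delta>) \<and>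
    (falsifies (term_model g) (term_assignment g) A \<longleftrightarrow> Neg A \<in> \<Delta>)"
proof (induction "fsize A" arbitrary: A rule: less_induct)
  case less
  let ?M = "term_model g" and ?\<alpha> = "term_assignment g"
  have ne: "univ ?M \<noteq> {}" using is_struct_term_model by (simp add: is_struct_def)
  \<comment> \<open>Assigning the element of \<open>t\<close> to \<open>x\<close> amounts to
    substituting \<open>t\<close>, and every element of the domain arises from a term.\<close>
  have inst:
    "verifies ?M (?\<alpha>(x := g (rep t))) B \<longleftrightarrow> subst x t B \<in> \<Delta>"
    "falsifies ?M (?\<alpha>(x := g (rep t))) B \<longleftrightarrow> Neg (subst x t B) \<in> \<Delta>"
    if "B \<in> LP \<Sigma>" "fsize B < fsize A" "t \<in> Terms \<Sigma>" for x t B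
    using less.hyps[of "subst x t B"] that verifies_subst[OF that(3), of ?M ?\<alpha>]
      falsifies_subst[OF that(3), of ?M ?\<alpha>]
    by (simp_all add: subst_LP val_tm_term_model)
  have univ: "univ ?M = (\<lambda>t. g (rep t)) ` Terms \<Sigma>" by (simp add: term_model_def)
  from less.prems show ?case
  proof cases
    case 1
    then show ?thesis using Falsity_notin Neg_Falsity_mem by simp
  next
    case (2 p ts)
    then have "map (val_tm ?M [] ?\<alpha>) ts = map (\<lambda>t. g (rep t)) ts" by (simp add: val_tm_term_model)
    then have "valuation ?M ?\<alpha> A = atom_value (Pred p (map rep ts))"
      unfolding valuation_def 2(1) by (simp only: val_fm.simps term_model_map_rep)
    moreover have "Pred p (map rep ts) \<in> LP \<Sigma>" using 2 by (auto intro!: LP.intros rep_Terms)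
    ultimately show ?thesis
      using 2 less.prems by (simp add: verifies_def falsifies_def atom_value_neq Pred_mem_map_rep)
  next
    case (3 s t)
    have sub: "Eq a b \<in> \<Delta> \<longleftrightarrow> Eq s t \<in> \<Delta>" if "a = rep s" "b = rep t" for a b
      using that 3 by (simp add: rep_rep rep_Terms flip: rep_eq_iff)
    have "Neg (Eq (rep s) (rep t)) \<in> \<Delta> \<longleftrightarrow> Neg (Eq s t) \<in> \<Delta>"
      using Neg_Eq_mem_cong Eq_rep_mem Eq_mem_sym 3 by blast
    moreover have "valuation ?M ?\<alpha> A = atom_value (Eq (rep s) (rep t))"
      using 3 g by (simp add: valuation_def val_tm_term_model) (simp add: term_model_def)
    ultimately show ?thesis
      using 3 sub by (simp add: verifies_def falsifies_def atom_value_neq LP_iffs rep_Terms)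
  next
    case (4 B)
    then show ?thesis using less.hyps[of B] by (simp add: Neg_mem_iffs)
  next
    case (5 B C)
    then show ?thesis using less.hyps[of B] less.hyps[of C]
      by (simp add: Neg_mem_iffs And_mem_iff Or_mem_iff LP_iffs)
  next
    case (6 B C)
    then show ?thesis using less.hyps[of B] less.hyps[of C]
      by (simp add: Neg_mem_iffs And_mem_iff Or_mem_iff LP_iffs)
  next
    case (7 B C)
    then show ?thesis using less.hyps[of B] less.hyps[of C]
      by (simp add: Neg_mem_iffs And_mem_iff Imp_mem_iff LP_iffs)
  next
    case (8 B x)
    then show ?thesis
      by (simp add: quantifier_simps[OF _ ne] univ inst Neg_mem_iffs Forall_mem_iff Exists_mem_iff LP_iffs)
  next
    case (9 B x)
    then show ?thesis
      by (simp add: quantifier_simps[OF _ ne] univ inst Neg_mem_iffs Forall_mem_iff Exists_mem_iff LP_iffs)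
  qed
qed

end

end

subsection \<open>Completeness\<close>

lemma entails_provable:
  fixes \<Gamma> :: "fm set"
  assumes inf: "infinite (UNIV :: 'u set)"
    and \<Gamma>: "finite \<Gamma>" "\<Gamma> \<subseteq> LP \<Sigma>" and A: "A \<in> LP \<Sigma>" and ent: "entails TYPE('u) \<Sigma> \<Gamma> A"
  shows "provable \<Sigma> (\<Gamma> \<turnstile> A)"
proof (rule ccontr)
  assume "\<not> provable \<Sigma> (\<Gamma> \<turnstile> A)"
  \<comment> \<open>\<Gamma> itself is one of the contexts over which \<open>derives\<close>
    quantifies.\<close>
  then have "\<not> derives \<Sigma> \<Gamma> A" using \<Gamma> by (auto simp: derives_def)
  then have cons: "\<not> derives \<Sigma> (insert (Imp A Falsity) \<Gamma>) Falsity"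
    using derives_ccontr A by blast
  define \<Delta> where "\<Delta> = (\<Union>n. henkin_chain \<Sigma> (insert (Imp A Falsity) \<Gamma>) n)"
  interpret henkin_set \<Sigma> \<Delta>
    unfolding \<Delta>_def using \<Gamma> A cons by (intro henkin_set_henkin_chain) (auto simp: LP_iffs)
  have sub: "insert (Imp A Falsity) \<Gamma> \<subseteq> \<Delta>"
    unfolding \<Delta>_def by (rule order_trans[OF _ UN_upper[of 0]]) simp_all
  \<comment> \<open>An infinite type contains a copy of the natural numbers, and hence codes of all
    terms.\<close>
  obtain h :: "nat \<Rightarrow> 'u" where "inj h" using infinite_countable_subset[OF inf] by blast
  then have g: "inj (h \<circ> to_nat :: tm \<Rightarrow> 'u)" by (simp add: inj_compose)
  note truth = term_model_truth[OF g]
  have "\<forall>B\<in>\<Gamma>. verifies (term_model (h \<circ> to_nat)) (term_assignment (h \<circ> to_nat)) B"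
    using truth sub \<Gamma>(2) by blast
  then have "verifies (term_model (h \<circ> to_nat)) (term_assignment (h \<circ> to_nat)) A"
    using ent is_struct_term_model[OF g] is_assignment_term_assignment[OF g]
    unfolding entails_iff_verifies by blast
  \<comment> \<open>Now \<Delta> contains both \<open>A\<close> and its classical negation.\<close>
  then have "A \<in> \<Delta>" using truth A by blast
  then show False using sub Imp_mem_elim Falsity_notin by blast
qed

theorem theorem1:
  fixes \<Sigma> :: signat and \<Gamma> :: "fm set" and A :: fm
  assumes "infinite (UNIV :: 'u set)"
    and "finite \<Gamma>" and "\<Gamma> \<subseteq> LP \<Sigma>" and "A \<in> LP \<Sigma>"
  shows "provable \<Sigma> (\<Gamma> \<turnstile> A) \<longleftrightarrow> entails TYPE('u) \<Sigma> \<Gamma> A"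
  using provable_sound entails_provable[OF assms] by blast

end
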